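(* Let $(X_n)_{n\in\mathbb{N}}$ be a sequence of Banach spaces, let $1\le p<\infty$, and let $X=\big(\sum_{n=1}^\infty\oplus X_n\big)_p$ be their $\ell_p$-sum. (1) If every $X_n$ is a $\mathcal{K}_{\sigma\delta}$ Banach space, then $X$ is a $\mathcal{K}_{\sigma\delta}$ Banach space. (2) If every $X_n$ is a strongly $\mathcal{K}_{\sigma\delta}$ Banach space, then $X$ is a strongly $\mathcal{K}_{\sigma\delta}$ Banach space.
   Context: Banach spaces are real. A subset $A$ of a topological space $T$ is $\mathcal{K}_{\sigma\delta}$ if there are compact subsets $K_{n,m}$ ($n,m\in\mathbb{N}$) of $T$ with $A=\bigcap_{n=1}^\infty\bigcup_{m=1}^\infty K_{n,m}$; it is strongly $\mathcal{K}_{\sigma\delta}$ if these can be chosen so that, in addition, for each compact $L\subseteq A$ and each $n$ there is $m$ with $L\subseteq K_{n,m}$. A Banach space $X$ is called $\mathcal{K}_{\sigma\delta}$ (resp. strongly $\mathcal{K}_{\sigma\delta}$) if $X$, canonically embedded in $X^{**}$, is a $\mathcal{K}_{\sigma\delta}$ (resp. strongly $\mathcal{K}_{\sigma\delta}$) subset of $(X^{**},w^* )$. *)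

theory Defs
  imports "HOL-Analysis.Analysis" "HOL-Library.Function_Algebras"
begin

text \<open>Real-valued and vector-valued functions form a real vector space pointwise;
  addition and zero come from \<^theory>\<open>HOL-Library.Function_Algebras\<close>.\<close>

instantiation "fun" :: (type, real_vector) real_vector
begin

definition scaleR_fun :: "real \<Rightarrow> ('a \<Rightarrow> 'b) \<Rightarrow> 'a \<Rightarrow> 'b"
  where "scaleR_fun c f = (\<lambda>x. c *\<^sub>R f x)"

instance
  by standard (auto simp: scaleR_fun_def fun_eq_iff scaleR_add_right scaleR_add_left)

end

text \<open>The spaces of a sequence may all be different, so a space is a value rather than a type:
  a linear subspace \<open>vecs\<close> of an ambient real vector space, which supplies only the linear
  operations, together with a norm of its own. The values of \<open>nrm\<close> outside \<open>vecs\<close> are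
  irrelevant. No generality is lost: any sequence of vector spaces embeds linearly in one
  ambient space, for instance in its direct sum.\<close>

record 'a nspace =
  vecs :: "'a set"
  nrm :: "'a \<Rightarrow> real"

definition normed_space :: "'a::real_vector nspace \<Rightarrow> bool" where
  "normed_space X \<longleftrightarrow>
     subspace (vecs X) \<and>
     (\<forall>x\<in>vecs X. 0 \<le> nrm X x \<and> (nrm X x = 0 \<longleftrightarrow> x = 0)) \<and>
     (\<forall>c. \<forall>x\<in>vecs X. nrm X (c *\<^sub>R x) = \<bar>c\<bar> * nrm X x) \<and>
     (\<forall>x\<in>vecs X. \<forall>y\<in>vecs X. nrm X (x + y) \<le> nrm X x + nrm X y)"

definition banach_space :: "'a::real_vector nspace \<Rightarrow> bool" where
  "banach_space X \<longleftrightarrow>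
     normed_space X \<and>
     (\<forall>\<sigma>::nat \<Rightarrow> 'a. (\<forall>n. \<sigma> n \<in> vecs X) \<longrightarrow>
        (\<forall>e>0. \<exists>M. \<forall>m\<ge>M. \<forall>n\<ge>M. nrm X (\<sigma> m - \<sigma> n) < e) \<longrightarrow>
        (\<exists>x\<in>vecs X. (\<lambda>n. nrm X (\<sigma> n - x)) \<longlonglongrightarrow> 0))"

text \<open>The dual space with the operator norm. A functional on \<open>vecs X\<close> is represented by its
  extension by \<open>0\<close> (in general not linear) to the ambient type, so that functionals agreeing on
  \<open>vecs X\<close> are equal and the linear operations are the pointwise ones.\<close>

definition dual :: "'a::real_vector nspace \<Rightarrow> ('a \<Rightarrow> real) nspace" where
  "dual X =
     \<lparr>vecs = {f. (\<forall>x. x \<notin> vecs X \<longrightarrow> f x = 0) \<and>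
                 (\<forall>x\<in>vecs X. \<forall>y\<in>vecs X. f (x + y) = f x + f y) \<and>
                 (\<forall>c. \<forall>x\<in>vecs X. f (c *\<^sub>R x) = c * f x) \<and>
                 (\<exists>C. \<forall>x\<in>vecs X. \<bar>f x\<bar> \<le> C * nrm X x)},
      nrm = (\<lambda>f. SUP x\<in>{x \<in> vecs X. nrm X x \<le> 1}. \<bar>f x\<bar>)\<rparr>"

text \<open>The weak* topology on the dual of \<open>X\<close>: the coarsest one making the evaluation at every
  point of \<open>X\<close> continuous.\<close>

definition weak_star :: "'a::real_vector nspace \<Rightarrow> ('a \<Rightarrow> real) topology" where
  "weak_star X =
     pullback_topology (vecs (dual X)) (\<lambda>f. restrict f (vecs X))
       (product_topology (\<lambda>x. euclideanreal) (vecs X))"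

definition canonical_embedding :: "'a::real_vector nspace \<Rightarrow> 'a \<Rightarrow> ('a \<Rightarrow> real) \<Rightarrow> real" where
  "canonical_embedding X x = (\<lambda>f. if f \<in> vecs (dual X) then f x else 0)"

definition K_sigma_delta_in :: "'a topology \<Rightarrow> 'a set \<Rightarrow> bool" where
  "K_sigma_delta_in T A \<longleftrightarrow>
     (\<exists>K::nat \<Rightarrow> nat \<Rightarrow> 'a set.
        (\<forall>n m. compactin T (K n m)) \<and> A = (\<Inter>n. \<Union>m. K n m))"

definition strongly_K_sigma_delta_in :: "'a topology \<Rightarrow> 'a set \<Rightarrow> bool" where
  "strongly_K_sigma_delta_in T A \<longleftrightarrow>
     (\<exists>K::nat \<Rightarrow> nat \<Rightarrow> 'a set.
        (\<forall>n m. compactin T (K n m)) \<and> A = (\<Inter>n. \<Union>m. K n m) \<and>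
        (\<forall>L n. compactin T L \<and> L \<subseteq> A \<longrightarrow> (\<exists>m. L \<subseteq> K n m)))"

text \<open>Since \<open>dual (dual X)\<close> is the bidual, its weak* topology is \<open>weak_star (dual X)\<close>.\<close>

definition K_sigma_delta_Banach :: "'a::real_vector nspace \<Rightarrow> bool" where
  "K_sigma_delta_Banach X \<longleftrightarrow>
     banach_space X \<and>
     K_sigma_delta_in (weak_star (dual X)) (canonical_embedding X ` vecs X)"

definition strongly_K_sigma_delta_Banach :: "'a::real_vector nspace \<Rightarrow> bool" where
  "strongly_K_sigma_delta_Banach X \<longleftrightarrow>
     banach_space X \<and>
     strongly_K_sigma_delta_in (weak_star (dual X)) (canonical_embedding X ` vecs X)"

definition lp_sum :: "real \<Rightarrow> (nat \<Rightarrow> 'a::real_vector nspace) \<Rightarrow> (nat \<Rightarrow> 'a) nspace" where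
  "lp_sum p X =
     \<lparr>vecs = {x. (\<forall>n. x n \<in> vecs (X n)) \<and> summable (\<lambda>n. nrm (X n) (x n) powr p)},
      nrm = (\<lambda>x. (\<Sum>n. nrm (X n) (x n) powr p) powr (1 / p))\<rparr>"

end

theory Submission
  imports Defs
begin

text \<open>
  An element \<open>z\<close> of the bidual of the sum \<open>S\<close> lies in \<open>S\<close> iff all its coordinate projections lie in
  the \<open>X\<^sub>n\<close> and \<open>z (f \<circ> T\<^sub>N)\<close> tends to \<open>0\<close> for every \<open>f\<close> in the dual, where \<open>T\<^sub>N\<close> sets the first
  \<open>N\<close> coordinates to \<open>0\<close>; no description of the bidual itself is needed, which matters for \<open>p = 1\<close>. The
  coordinate conditions are pulled back from the given coverings, intersected with balls to restore
  compactness. For \<open>p > 1\<close> the tail condition is automatic, because \<open>f \<circ> T\<^sub>N\<close> tends to \<open>0\<close>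
  in norm. For \<open>p = 1\<close> it is imposed in the form that for each \<open>\<epsilon>\<close> there is \<open>N\<close> such that
  \<open>f \<mapsto> z (f \<circ> T\<^sub>N)\<close> has norm at most \<open>\<epsilon>\<close>, and a
  gliding hump shows that a weakly compact subset of \<open>S\<close> has uniformly small tails, so that it lies
  in a single member of the covering.
\<close>

subsection \<open>Sublinear functionals and the Hahn--Banach theorem\<close>

text \<open>Coordinates alone do not suffice for \<open>p = 1\<close>: in the bidual of scalar
  \<open>\<ell>\<^sub>1\<close>, a Banach limit is a nonzero element all of whose coordinates
  vanish. The condition that \<open>z\<close> tends to \<open>0\<close> on the tails of every
  \<open>f\<close> involves uncountably many \<open>f\<close> with no common \<open>N\<close>, so it
  is not visibly a countable intersection of countable unions. Bounding the norm on tails makes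
  \<open>N\<close> independent of \<open>f\<close>; for fixed \<open>N\<close> and \<epsilon> this
  is an intersection of weak* closed conditions, and vectors of the sum satisfy it because their
  tails tend to \<open>0\<close> in norm.

  In the strong statement one ball and one \<open>N\<close> must serve a whole compact set. The ball
  comes from uniform boundedness, with vectors regarded as functionals on the dual. The choice of
  \<open>N\<close> separates the two ranges of \<open>p\<close>: in scalar
  \<open>\<ell>\<^sub>2\<close> the unit vectors together with \<open>0\<close> form a weakly
  compact set without uniformly small tails.\<close>

definition sublinear_on :: "'a::real_vector set \<Rightarrow> ('a \<Rightarrow> real) \<Rightarrow> bool" where
  "sublinear_on V q \<longleftrightarrow>
     (\<forall>x\<in>V. \<forall>y\<in>V. q (x + y) \<le> q x + q y) \<and> (\<forall>c\<ge>0. \<forall>x\<in>V. q (c *\<^sub>R x) = c * q x)"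

lemma sublinear_on_add: "sublinear_on V q \<Longrightarrow> x \<in> V \<Longrightarrow> y \<in> V \<Longrightarrow> q (x + y) \<le> q x + q y"
  by (simp add: sublinear_on_def)

lemma sublinear_on_scale: "sublinear_on V q \<Longrightarrow> 0 \<le> c \<Longrightarrow> x \<in> V \<Longrightarrow> q (c *\<^sub>R x) = c * q x"
  by (simp add: sublinear_on_def)

lemma sublinear_on_zero: "subspace V \<Longrightarrow> sublinear_on V q \<Longrightarrow> q 0 = 0"
  using sublinear_on_scale[of V q 0 0] subspace_0 by fastforce

lemma sublinear_on_minus:
  assumes "subspace V" "sublinear_on V q" "x \<in> V"
  shows "- q (- x) \<le> q x"
  using sublinear_on_add[of V q x "- x"] sublinear_on_zero[of V q] subspace_neg[of V x] assms
  by simp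

text \<open>The bounding index \<open>k\<close> may depend on the points: the descent step uses sums
  and multiples of parameters, the infimum of a chain uses one of its two members. One inequality
  for \<open>c > 0\<close> is enough for homogeneity, since applying it to \<open>1 / c\<close>
  reverses it.\<close>

lemma sublinear_on_INF:
  assumes V: "subspace V" and I: "I \<noteq> {}"
    and bdd: "\<And>x. x \<in> V \<Longrightarrow> bdd_below ((\<lambda>i. q i x) ` I)"
    and add: "\<And>x y i j. x \<in> V \<Longrightarrow> y \<in> V \<Longrightarrow> i \<in> I \<Longrightarrow> j \<in> I \<Longrightarrow> \<exists>k\<in>I. q k (x + y) \<le> q i x + q j y"
    and scale: "\<And>x c i. x \<in> V \<Longrightarrow> 0 < c \<Longrightarrow> i \<in> I \<Longrightarrow> \<exists>k\<in>I. q k (c *\<^sub>R x) \<le> c * q i x"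
    and zero: "\<And>i. i \<in> I \<Longrightarrow> q i 0 = 0"
  shows "sublinear_on V (\<lambda>x. INF i\<in>I. q i x)"
  unfolding sublinear_on_def
proof (intro conjI ballI allI impI)
  fix x y assume x: "x \<in> V" and y: "y \<in> V"
  let ?F = "\<lambda>x. INF i\<in>I. q i x"
  have xy: "x + y \<in> V"
    using V x y by (simp add: subspace_add)
  have *: "?F (x + y) \<le> q i x + q j y" if "i \<in> I" "j \<in> I" for i j
    using add[OF x y that] cINF_lower[OF bdd[OF xy]] by (meson order_trans)
  have "?F (x + y) - q j y \<le> ?F x" if "j \<in> I" for j
    using *[OF _ that] by (intro cINF_greatest I) (simp add: algebra_simps)
  hence "?F (x + y) - ?F x \<le> ?F y"
    by (intro cINF_greatest I) (simp add: algebra_simps)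
  thus "?F (x + y) \<le> ?F x + ?F y" by simp
next
  fix c :: real and x assume c: "0 \<le> c" and x: "x \<in> V"
  let ?F = "\<lambda>x. INF i\<in>I. q i x"
  have le: "?F (c *\<^sub>R x) \<le> c * ?F x" if c: "0 < c" and x: "x \<in> V" for c x
  proof -
    have cx: "c *\<^sub>R x \<in> V" using V x by (simp add: subspace_scale)
    have "?F (c *\<^sub>R x) / c \<le> ?F x"
    proof (intro cINF_greatest I)
      fix i assume "i \<in> I"
      then obtain k where "k \<in> I" "q k (c *\<^sub>R x) \<le> c * q i x" using scale[OF x c] by blast
      hence "?F (c *\<^sub>R x) \<le> c * q i x"
        using cINF_lower[OF bdd[OF cx]] by (meson order_trans)
      thus "?F (c *\<^sub>R x) / c \<le> q i x" using c by (simp add: field_simps)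
    qed
    thus ?thesis using c by (simp add: field_simps)
  qed
  show "?F (c *\<^sub>R x) = c * ?F x"
  proof (cases "c = 0")
    case True
    have "?F 0 = 0" using zero I by simp
    thus ?thesis using True by simp
  next
    case False
    hence c: "0 < c" using c by simp
    have "?F ((1/c) *\<^sub>R (c *\<^sub>R x)) \<le> (1/c) * ?F (c *\<^sub>R x)"
      using c x V by (intro le) (simp_all add: subspace_scale)
    thus ?thesis using le[OF c x] c by (simp add: field_simps)
  qed
qed

text \<open>The descent step of the minimality argument: the modified functional lies below \<open>q\<close>, and
  it equals \<open>q\<close> only if \<open>q\<close> is additive in the direction \<open>a\<close>.\<close>

lemma sublinear_on_descent:
  assumes V: "subspace V" and q: "sublinear_on V q" and a: "a \<in> V"
  obtains r where "sublinear_on V r" "\<And>x. x \<in> V \<Longrightarrow> r x \<le> q x"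
    "\<And>x. x \<in> V \<Longrightarrow> r x \<le> q (x + a) - q a"
proof
  \<comment> \<open>In the infimum over \<open>t \<ge> 0\<close>, the value \<open>t = 0\<close>
    gives \<open>r \<le> q\<close> and \<open>t = 1\<close> gives the bound in the direction
    \<open>a\<close>. The infimum is finite because \<open>- q (- x)\<close> bounds
    \<open>g t x\<close> from below.\<close>
  define g where "g t x = q (x + t *\<^sub>R a) - t * q a" for t x
  define r where "r x = (INF t\<in>{0..}. g t x)" for x
  have V': "x + t *\<^sub>R a \<in> V" if "x \<in> V" for x t
    using V a that by (simp add: subspace_add subspace_scale)
  have lower: "- q (- x) \<le> g t x" if "x \<in> V" "0 \<le> t" for x t
    using sublinear_on_add[OF q V'[OF that(1), of t] subspace_neg[OF V that(1)]]
      sublinear_on_scale[OF q that(2) a] by (simp add: g_def)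
  have bdd: "bdd_below ((\<lambda>t. g t x) ` {0..})" if "x \<in> V" for x
    using lower[OF that] by (intro bdd_belowI2) auto
  show "sublinear_on V r"
    unfolding r_def
  proof (rule sublinear_on_INF[OF V _ bdd])
    fix x y :: 'a and s t :: real
    assume "x \<in> V" "y \<in> V" "s \<in> {0..}" "t \<in> {0..}"
    moreover from this have "g (s + t) (x + y) \<le> g s x + g t y"
      using sublinear_on_add[OF q V' V', of x y s t] by (simp add: g_def algebra_simps)
    ultimately show "\<exists>k\<in>{0..}. g k (x + y) \<le> g s x + g t y"
      by (intro bexI[of _ "s + t"]) auto
  next
    fix x :: 'a and c t :: real
    assume *: "x \<in> V" "0 < c" "t \<in> {0..}"
    hence "g (c * t) (c *\<^sub>R x) = c * g t x"
      using sublinear_on_scale[OF q _ V', of c x t] by (simp add: g_def algebra_simps)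
    thus "\<exists>k\<in>{0..}. g k (c *\<^sub>R x) \<le> c * g t x"
      using * by (intro bexI[of _ "c * t"]) auto
  next
    fix t :: real assume "t \<in> {0..}"
    thus "g t 0 = 0" using sublinear_on_scale[OF q _ a] by (simp add: g_def)
  qed auto
  fix x assume x: "x \<in> V"
  show "r x \<le> q x"
    using cINF_lower[OF bdd[OF x], of 0] by (simp add: r_def g_def)
  show "r x \<le> q (x + a) - q a"
    using cINF_lower[OF bdd[OF x], of 1] by (simp add: r_def g_def)
qed

text \<open>Zorn's lemma downwards: the infimum of a chain is again sublinear, and
  \<open>- p (- x)\<close> bounds all members from below at \<open>x\<close>. Minimality matters
  because it forces linearity.\<close>

lemma minimal_sublinear_on:
  assumes V: "subspace V" and p: "sublinear_on V p"
  obtains q where "sublinear_on V q" "\<And>x. x \<in> V \<Longrightarrow> q x \<le> p x"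
    "\<And>r x. sublinear_on V r \<Longrightarrow> (\<And>x. x \<in> V \<Longrightarrow> r x \<le> q x) \<Longrightarrow> x \<in> V \<Longrightarrow> r x = q x"
proof -
  \<comment> \<open>Values outside \<open>V\<close> are fixed to \<open>0\<close>, so that the order
    \<open>R\<close>, which sees only \<open>V\<close>, is antisymmetric. \<open>R\<close> is
    reversed, which turns the maximal element of Zorn's lemma into a minimal functional.\<close>
  define A where "A = {q. sublinear_on V q \<and> (\<forall>x\<in>V. q x \<le> p x) \<and> (\<forall>x. x \<notin> V \<longrightarrow> q x = 0)}"
  define R where "R = (\<lambda>q r :: 'a \<Rightarrow> real. \<forall>x\<in>V. r x \<le> q x)"
  have restrict_A: "(\<lambda>x. if x \<in> V then r x else 0) \<in> A"
    if "sublinear_on V r" "\<And>x. x \<in> V \<Longrightarrow> r x \<le> p x" for r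
    using that V by (auto simp: A_def sublinear_on_def subspace_add subspace_scale)
  have "\<exists>m\<in>A. \<forall>a\<in>A. R m a \<longrightarrow> a = m"
  proof (rule predicate_Zorn)
    show "partial_order_on A (relation_of R A)"
    proof (rule partial_order_on_relation_ofI)
      fix a b c assume "R a b" "R b c" thus "R a c"
        unfolding R_def by (meson order_trans)
    next
      fix a b assume "a \<in> A" "b \<in> A" "R a b" "R b a"
      hence "a x = b x" for x by (cases "x \<in> V") (auto simp: R_def A_def intro: order_antisym)
      thus "a = b" by (rule ext)
    qed (auto simp: R_def)
  next
    fix C assume C: "C \<in> Chains (relation_of R A)"
    hence CA: "C \<subseteq> A" by (auto simp: Chains_def relation_of_def)
    have CR: "R f g \<or> R g f" if "f \<in> C" "g \<in> C" for f g
      using C that by (auto simp: Chains_def relation_of_def)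
    show "\<exists>u\<in>A. \<forall>a\<in>C. R a u"
    proof (cases "C = {}")
      case True
      thus ?thesis using restrict_A[OF p] by auto
    next
      case False
      define u where "u x = (INF f\<in>C. f x)" for x
      have bdd: "bdd_below ((\<lambda>f. f x) ` C)" if "x \<in> V" for x
      proof (rule bdd_belowI2)
        fix f assume "f \<in> C"
        hence "f \<in> A" using CA by blast
        hence "- p (- x) \<le> - f (- x)" "- f (- x) \<le> f x"
          using that V sublinear_on_minus[OF V _ that, of f] by (auto simp: A_def subspace_neg)
        thus "- p (- x) \<le> f x" by linarith
      qed
      have u: "sublinear_on V u"
        unfolding u_def
      proof (rule sublinear_on_INF[OF V False bdd])
        fix x y f g assume *: "x \<in> V" "y \<in> V" "f \<in> C" "g \<in> C"
        hence fg: "f (x + y) \<le> f x + f y" "g (x + y) \<le> g x + g y"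
          using CA by (auto simp: A_def sublinear_on_def)
        from CR[OF *(3,4)] show "\<exists>k\<in>C. k (x + y) \<le> f x + g y"
        proof
          assume "R f g"
          hence "g x \<le> f x" using * by (simp add: R_def)
          with fg show ?thesis using * by (intro bexI[of _ g]) auto
        next
          assume "R g f"
          hence "f y \<le> g y" using * by (simp add: R_def)
          with fg show ?thesis using * by (intro bexI[of _ f]) auto
        qed
      next
        fix x f and c :: real assume "x \<in> V" "0 < c" "f \<in> C"
        moreover from this have "f (c *\<^sub>R x) = c * f x"
          using CA by (auto simp: A_def sublinear_on_def)
        ultimately show "\<exists>k\<in>C. k (c *\<^sub>R x) \<le> c * f x" by (intro bexI[of _ f]) auto
      next
        fix f assume "f \<in> C"
        thus "f 0 = 0" using CA sublinear_on_zero[OF V] by (auto simp: A_def)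
      qed
      have le: "u x \<le> f x" if "f \<in> C" "x \<in> V" for f x
        unfolding u_def using cINF_lower[OF bdd[OF that(2)] that(1)] .
      have "u x \<le> p x" if "x \<in> V" for x
      proof -
        obtain f where f: "f \<in> C" using False by blast
        hence "f x \<le> p x" using CA that by (auto simp: A_def)
        thus ?thesis using le[OF f that] by linarith
      qed
      from restrict_A[OF u this] show ?thesis
        by (rule bexI[rotated]) (auto simp: R_def le)
    qed
  qed
  then obtain q where q: "q \<in> A" and min: "\<And>a. a \<in> A \<Longrightarrow> R q a \<Longrightarrow> a = q" by blast
  show thesis
  proof
    show "sublinear_on V q" "\<And>x. x \<in> V \<Longrightarrow> q x \<le> p x" using q by (auto simp: A_def)
    fix r x assume r: "sublinear_on V r" "\<And>x. x \<in> V \<Longrightarrow> r x \<le> q x" and x: "x \<in> V"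
    have "(\<lambda>x. if x \<in> V then r x else 0) \<in> A"
      using r q by (intro restrict_A) (auto simp: A_def intro: order_trans)
    hence "(\<lambda>x. if x \<in> V then r x else 0) = q"
      by (rule min) (auto simp: R_def r)
    from fun_cong[OF this, of x] show "r x = q x" using x by simp
  qed
qed

text \<open>Additivity comes from minimality: the descent in the direction \<open>y\<close> cannot
  lower \<open>f\<close>, whence \<open>f x \<le> f (x + y) - f y\<close>. Lowering \<open>p\<close>
  once in the direction \<open>a\<close> before minimising forces \<open>f a = p a\<close>.\<close>

theorem Hahn_Banach_sublinear:
  assumes V: "subspace V" and p: "sublinear_on V p" and a: "a \<in> V"
  obtains f where "\<And>x y. x \<in> V \<Longrightarrow> y \<in> V \<Longrightarrow> f (x + y) = f x + f y"
    "\<And>c x. x \<in> V \<Longrightarrow> f (c *\<^sub>R x) = c * f x" "\<And>x. x \<in> V \<Longrightarrow> f x \<le> p x" "f a = p a"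
proof -
  obtain p' where p': "sublinear_on V p'" "\<And>x. x \<in> V \<Longrightarrow> p' x \<le> p x"
    "\<And>x. x \<in> V \<Longrightarrow> p' x \<le> p (x + a) - p a"
    using sublinear_on_descent[OF V p a] by blast
  obtain f where f: "sublinear_on V f" "\<And>x. x \<in> V \<Longrightarrow> f x \<le> p' x"
    and min: "\<And>r x. sublinear_on V r \<Longrightarrow> (\<And>x. x \<in> V \<Longrightarrow> r x \<le> f x) \<Longrightarrow> x \<in> V \<Longrightarrow> r x = f x"
    using minimal_sublinear_on[OF V p'(1)] by blast
  have add: "f (x + y) = f x + f y" if x: "x \<in> V" and y: "y \<in> V" for x y
  proof -
    obtain r where r: "sublinear_on V r" "\<And>x. x \<in> V \<Longrightarrow> r x \<le> f x"
      "\<And>x. x \<in> V \<Longrightarrow> r x \<le> f (x + y) - f y"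
      using sublinear_on_descent[OF V f(1) y] by blast
    have "f x = r x" using min[OF r(1,2) x] by simp
    also have "\<dots> \<le> f (x + y) - f y" by (rule r(3)[OF x])
    finally show ?thesis using sublinear_on_add[OF f(1) x y] by simp
  qed
  have neg: "f (- x) = - f x" if "x \<in> V" for x
    using add[OF that subspace_neg[OF V that]] sublinear_on_zero[OF V f(1)] by simp
  have scale: "f (c *\<^sub>R x) = c * f x" if x: "x \<in> V" for c x
  proof (cases "0 \<le> c")
    case True thus ?thesis using sublinear_on_scale[OF f(1) _ x] by simp
  next
    case False
    hence "f (c *\<^sub>R x) = - f ((- c) *\<^sub>R x)"
      using neg[of "(- c) *\<^sub>R x"] subspace_scale[OF V x, of "- c"] by simp
    also have "\<dots> = c * f x" using sublinear_on_scale[OF f(1) _ x, of "- c"] False by simp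
    finally show ?thesis .
  qed
  have le: "f x \<le> p x" if "x \<in> V" for x using f(2) p'(2) that by (meson order_trans)
  have ma: "- a \<in> V" using V a by (rule subspace_neg)
  \<comment> \<open>At \<open>- a\<close> the modified bound is \<open>p 0 - p a = - p a\<close>,
    which is the missing inequality \<open>p a \<le> f a\<close>.\<close>
  have "f (- a) \<le> p (- a + a) - p a" using f(2)[OF ma] p'(3)[OF ma] by linarith
  hence "f a = p a"
    using neg[OF a] le[OF a] sublinear_on_zero[OF V p] by simp
  with add scale le show thesis by (rule that)
qed

subsection \<open>Normed spaces, duals and biduals\<close>

lemma scaleR_fun_apply: "(c *\<^sub>R f) x = c *\<^sub>R f x"
  by (simp add: scaleR_fun_def)

lemma normed_spaceD:
  assumes "normed_space X"
  shows normed_space_subspace: "subspace (vecs X)"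
    and nrm_nonneg: "\<And>x. x \<in> vecs X \<Longrightarrow> 0 \<le> nrm X x"
    and nrm_eq_0: "\<And>x. x \<in> vecs X \<Longrightarrow> nrm X x = 0 \<longleftrightarrow> x = 0"
    and nrm_scale: "\<And>c x. x \<in> vecs X \<Longrightarrow> nrm X (c *\<^sub>R x) = \<bar>c\<bar> * nrm X x"
    and nrm_triangle: "\<And>x y. x \<in> vecs X \<Longrightarrow> y \<in> vecs X \<Longrightarrow> nrm X (x + y) \<le> nrm X x + nrm X y"
    and vecs_zero: "0 \<in> vecs X"
    and vecs_add: "\<And>x y. x \<in> vecs X \<Longrightarrow> y \<in> vecs X \<Longrightarrow> x + y \<in> vecs X"
    and vecs_diff: "\<And>x y. x \<in> vecs X \<Longrightarrow> y \<in> vecs X \<Longrightarrow> x - y \<in> vecs X"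
    and vecs_scale: "\<And>c x. x \<in> vecs X \<Longrightarrow> c *\<^sub>R x \<in> vecs X"
  using assms
  by (auto simp: normed_space_def subspace_0 subspace_add subspace_diff subspace_scale)

lemma nrm_zero: "normed_space X \<Longrightarrow> nrm X 0 = 0"
  using nrm_eq_0 vecs_zero by blast

lemma nrm_diff_commute:
  assumes "normed_space X" "x \<in> vecs X" "y \<in> vecs X"
  shows "nrm X (x - y) = nrm X (y - x)"
  using nrm_scale[of X "x - y" "-1"] vecs_diff[of X x y] assms by simp

lemma nrm_triangle_diff:
  assumes "normed_space X" "x \<in> vecs X" "y \<in> vecs X" "z \<in> vecs X"
  shows "nrm X (x - z) \<le> nrm X (x - y) + nrm X (y - z)"
  using nrm_triangle[of X "x - y" "y - z"] vecs_diff[of X] assms by simp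

lemma dual_iff:
  "f \<in> vecs (dual X) \<longleftrightarrow>
     (\<forall>x. x \<notin> vecs X \<longrightarrow> f x = 0) \<and>
     (\<forall>x\<in>vecs X. \<forall>y\<in>vecs X. f (x + y) = f x + f y) \<and>
     (\<forall>c. \<forall>x\<in>vecs X. f (c *\<^sub>R x) = c * f x) \<and> (\<exists>C. \<forall>x\<in>vecs X. \<bar>f x\<bar> \<le> C * nrm X x)"
  by (simp add: dual_def)

lemma dualI:
  assumes "\<And>x. x \<notin> vecs X \<Longrightarrow> f x = 0"
    and "\<And>x y. x \<in> vecs X \<Longrightarrow> y \<in> vecs X \<Longrightarrow> f (x + y) = f x + f y"
    and "\<And>c x. x \<in> vecs X \<Longrightarrow> f (c *\<^sub>R x) = c * f x"
    and "\<And>x. x \<in> vecs X \<Longrightarrow> \<bar>f x\<bar> \<le> C * nrm X x"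
  shows "f \<in> vecs (dual X)"
  unfolding dual_iff using assms by blast

lemma dual_outside: "f \<in> vecs (dual X) \<Longrightarrow> x \<notin> vecs X \<Longrightarrow> f x = 0"
  and dual_add: "f \<in> vecs (dual X) \<Longrightarrow> x \<in> vecs X \<Longrightarrow> y \<in> vecs X \<Longrightarrow> f (x + y) = f x + f y"
  and dual_scale: "f \<in> vecs (dual X) \<Longrightarrow> x \<in> vecs X \<Longrightarrow> f (c *\<^sub>R x) = c * f x"
  by (auto simp: dual_iff)

lemma dual_zero: "normed_space X \<Longrightarrow> f \<in> vecs (dual X) \<Longrightarrow> f 0 = 0"
  using dual_scale[of f X 0 0] vecs_zero[of X] by simp

lemma dual_sum:
  assumes X: "normed_space X" and f: "f \<in> vecs (dual X)" and "finite I"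
    and "\<And>i. i \<in> I \<Longrightarrow> x i \<in> vecs X"
  shows "f (\<Sum>i\<in>I. x i) = (\<Sum>i\<in>I. f (x i))"
  using assms(3,4)
proof (induction I rule: finite_induct)
  case empty
  show ?case using dual_zero[OF X f] by (simp only: sum.empty)
next
  case (insert i I)
  have "(\<Sum>i\<in>I. x i) \<in> vecs X"
    using insert.prems by (intro subspace_sum normed_space_subspace[OF X]) auto
  thus ?case using insert dual_add[OF f] by simp
qed

lemma nrm_dual_le:
  assumes X: "normed_space X" and C: "0 \<le> C" "\<And>x. x \<in> vecs X \<Longrightarrow> \<bar>f x\<bar> \<le> C * nrm X x"
  shows "nrm (dual X) f \<le> C"
proof -
  have "(SUP x\<in>{x \<in> vecs X. nrm X x \<le> 1}. \<bar>f x\<bar>) \<le> C"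
  proof (rule cSUP_least)
    show "{x \<in> vecs X. nrm X x \<le> 1} \<noteq> {}"
      using vecs_zero[OF X] nrm_zero[OF X] by force
    fix x assume x: "x \<in> {x \<in> vecs X. nrm X x \<le> 1}"
    hence "C * nrm X x \<le> C * 1" using C(1) by (intro mult_left_mono) auto
    thus "\<bar>f x\<bar> \<le> C" using C(2)[of x] x by simp
  qed
  thus ?thesis by (simp add: dual_def)
qed

lemma dual_ball_le:
  assumes X: "normed_space X" and f: "f \<in> vecs (dual X)" and x: "x \<in> vecs X" "nrm X x \<le> 1"
  shows "\<bar>f x\<bar> \<le> nrm (dual X) f"
proof -
  obtain C where C: "\<And>x. x \<in> vecs X \<Longrightarrow> \<bar>f x\<bar> \<le> C * nrm X x"
    using f unfolding dual_iff by blast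
  have "bdd_above ((\<lambda>x. \<bar>f x\<bar>) ` {x \<in> vecs X. nrm X x \<le> 1})"
  proof (rule bdd_aboveI2)
    fix x assume x: "x \<in> {x \<in> vecs X. nrm X x \<le> 1}"
    have "\<bar>f x\<bar> \<le> C * nrm X x" using C x by blast
    also have "\<dots> \<le> \<bar>C\<bar> * 1"
      using x nrm_nonneg[OF X, of x] by (intro mult_mono) auto
    finally show "\<bar>f x\<bar> \<le> \<bar>C\<bar>" by simp
  qed
  from cSUP_upper[OF _ this, of x] show ?thesis using x by (simp add: dual_def)
qed

lemma nrm_dual_nonneg: "normed_space X \<Longrightarrow> f \<in> vecs (dual X) \<Longrightarrow> 0 \<le> nrm (dual X) f"
  using dual_ball_le[of X f 0] vecs_zero[of X] nrm_zero[of X] by simp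

lemma dual_le:
  assumes X: "normed_space X" and f: "f \<in> vecs (dual X)" and x: "x \<in> vecs X"
  shows "\<bar>f x\<bar> \<le> nrm (dual X) f * nrm X x"
proof (cases "x = 0")
  case True
  thus ?thesis using dual_zero[OF X f] nrm_zero[OF X] by simp
next
  case False
  hence pos: "0 < nrm X x" using nrm_nonneg[OF X x] nrm_eq_0[OF X x] by linarith
  define y where "y = (1 / nrm X x) *\<^sub>R x"
  have "y \<in> vecs X" "nrm X y = 1"
    using pos x X by (auto simp: y_def vecs_scale nrm_scale)
  hence "\<bar>f y\<bar> \<le> nrm (dual X) f" using dual_ball_le[OF X f] by simp
  thus ?thesis using pos dual_scale[OF f x] by (simp add: y_def abs_mult field_simps)
qed

lemma dual_le_const:
  assumes X: "normed_space X" and f: "f \<in> vecs (dual X)" "nrm (dual X) f \<le> C" and x: "x \<in> vecs X"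
  shows "\<bar>f x\<bar> \<le> C * nrm X x"
  using dual_le[OF X f(1) x] mult_right_mono[OF f(2) nrm_nonneg[OF X x]] by linarith

lemma vecs_dual_subspace:
  assumes X: "normed_space X"
  shows "subspace (vecs (dual X))"
proof (rule subspaceI)
  show "0 \<in> vecs (dual X)"
    by (rule dualI[where C = 0]) auto
next
  fix f g assume fg: "f \<in> vecs (dual X)" "g \<in> vecs (dual X)"
  show "f + g \<in> vecs (dual X)"
  proof (rule dualI[where C = "nrm (dual X) f + nrm (dual X) g"])
    fix x assume "x \<in> vecs X"
    thus "\<bar>(f + g) x\<bar> \<le> (nrm (dual X) f + nrm (dual X) g) * nrm X x"
      using dual_le[OF X fg(1), of x] dual_le[OF X fg(2), of x] by (simp add: distrib_right)
  qed (use fg in \<open>auto simp: dual_outside dual_add dual_scale algebra_simps\<close>)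
next
  fix c f assume f: "f \<in> vecs (dual X)"
  show "c *\<^sub>R f \<in> vecs (dual X)"
  proof (rule dualI[where C = "\<bar>c\<bar> * nrm (dual X) f"])
    fix x assume "x \<in> vecs X"
    thus "\<bar>(c *\<^sub>R f) x\<bar> \<le> \<bar>c\<bar> * nrm (dual X) f * nrm X x"
      using dual_le[OF X f, of x] by (simp add: scaleR_fun_apply abs_mult mult_left_mono mult.assoc)
  qed (use f in \<open>auto simp: scaleR_fun_apply dual_outside dual_add dual_scale algebra_simps\<close>)
qed

lemma normed_space_dual:
  assumes X: "normed_space X"
  shows "normed_space (dual X)"
  unfolding normed_space_def
proof (intro conjI ballI allI)
  show V: "subspace (vecs (dual X))" by (rule vecs_dual_subspace[OF X])
  fix f assume f: "f \<in> vecs (dual X)"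
  show nonneg: "0 \<le> nrm (dual X) f" by (rule nrm_dual_nonneg[OF X f])
  show "nrm (dual X) f = 0 \<longleftrightarrow> f = 0"
  proof
    assume "nrm (dual X) f = 0"
    hence "f x = 0" for x
      using dual_le[OF X f, of x] dual_outside[OF f, of x] by (cases "x \<in> vecs X") auto
    thus "f = 0" by (simp add: fun_eq_iff)
  next
    assume "f = 0"
    hence "nrm (dual X) f \<le> 0" by (intro nrm_dual_le[OF X]) auto
    thus "nrm (dual X) f = 0" using nonneg by simp
  qed
  fix c :: real
  have le: "nrm (dual X) (c *\<^sub>R f) \<le> \<bar>c\<bar> * nrm (dual X) f" if "f \<in> vecs (dual X)" for c f
    using dual_le[OF X that] nrm_dual_nonneg[OF X that]
    by (intro nrm_dual_le[OF X]) (auto simp: scaleR_fun_apply abs_mult mult_left_mono mult.assoc)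
  show "nrm (dual X) (c *\<^sub>R f) = \<bar>c\<bar> * nrm (dual X) f"
  proof (cases "c = 0")
    case True thus ?thesis using le[OF f, of c] nrm_dual_nonneg[OF X subspace_scale[OF V f], of c] by simp
  next
    case False
    have "nrm (dual X) ((1/c) *\<^sub>R (c *\<^sub>R f)) \<le> \<bar>1/c\<bar> * nrm (dual X) (c *\<^sub>R f)"
      using V f by (intro le) (simp add: subspace_scale)
    thus ?thesis using le[OF f, of c] False by (simp add: field_simps)
  qed
next
  fix f g assume fg: "f \<in> vecs (dual X)" "g \<in> vecs (dual X)"
  show "nrm (dual X) (f + g) \<le> nrm (dual X) f + nrm (dual X) g"
  proof (rule nrm_dual_le[OF X])
    fix x assume "x \<in> vecs X"
    thus "\<bar>(f + g) x\<bar> \<le> (nrm (dual X) f + nrm (dual X) g) * nrm X x"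
      using dual_le[OF X fg(1), of x] dual_le[OF X fg(2), of x] by (simp add: distrib_right)
  qed (use nrm_dual_nonneg[OF X] fg in auto)
qed

lemma norming_functional:
  assumes X: "normed_space X" and a: "a \<in> vecs X"
  obtains f where "f \<in> vecs (dual X)" "\<And>x. x \<in> vecs X \<Longrightarrow> \<bar>f x\<bar> \<le> nrm X x" "f a = nrm X a"
proof -
  note V = normed_space_subspace[OF X]
  have "sublinear_on (vecs X) (nrm X)"
    using X by (auto simp: sublinear_on_def nrm_triangle nrm_scale)
  from Hahn_Banach_sublinear[OF V this a] obtain f where
    add: "\<And>x y. x \<in> vecs X \<Longrightarrow> y \<in> vecs X \<Longrightarrow> f (x + y) = f x + f y" and
    scale: "\<And>c x. x \<in> vecs X \<Longrightarrow> f (c *\<^sub>R x) = c * f x" and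
    le: "\<And>x. x \<in> vecs X \<Longrightarrow> f x \<le> nrm X x" and fa: "f a = nrm X a"
    by blast
  have abs: "\<bar>f x\<bar> \<le> nrm X x" if x: "x \<in> vecs X" for x
    using le[OF x] le[OF vecs_scale[OF X x, of "-1"]] scale[OF x, of "-1"] nrm_scale[OF X x, of "-1"]
    by simp
  show thesis
  proof
    show "(\<lambda>x. if x \<in> vecs X then f x else 0) \<in> vecs (dual X)"
      by (rule dualI[where C = 1]) (use X in \<open>auto simp: add scale abs vecs_add vecs_scale\<close>)
  qed (use abs fa a in auto)
qed

section \<open>The canonical embedding into the bidual, and series of functionals\<close>

lemma canonical_embedding_apply:
  "f \<in> vecs (dual X) \<Longrightarrow> canonical_embedding X x f = f x"
  by (simp add: canonical_embedding_def)

lemma canonical_embedding_in_bidual: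
  assumes X: "normed_space X" and x: "x \<in> vecs X"
  shows "canonical_embedding X x \<in> vecs (dual (dual X))"
proof (rule dualI[where C = "nrm X x"])
  fix f assume "f \<in> vecs (dual X)"
  thus "\<bar>canonical_embedding X x f\<bar> \<le> nrm X x * nrm (dual X) f"
    using dual_le[OF X _ x, of f] by (simp add: canonical_embedding_apply mult.commute)
qed (use vecs_dual_subspace[OF X] in
      \<open>auto simp: canonical_embedding_def subspace_add subspace_scale scaleR_fun_apply\<close>)

lemma nrm_canonical_embedding_le:
  assumes X: "normed_space X" and x: "x \<in> vecs X"
  shows "nrm (dual (dual X)) (canonical_embedding X x) \<le> nrm X x"
proof (rule nrm_dual_le[OF normed_space_dual[OF X] nrm_nonneg[OF X x]])
  fix f assume "f \<in> vecs (dual X)"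
  thus "\<bar>canonical_embedding X x f\<bar> \<le> nrm X x * nrm (dual X) f"
    using dual_le[OF X _ x, of f] by (simp add: canonical_embedding_apply mult.commute)
qed

lemma nrm_le_if_dual_ball_le:
  assumes X: "normed_space X" and x: "x \<in> vecs X"
    and le: "\<And>f. f \<in> vecs (dual X) \<Longrightarrow> nrm (dual X) f \<le> 1 \<Longrightarrow> f x \<le> C"
  shows "nrm X x \<le> C"
proof -
  obtain f where f: "f \<in> vecs (dual X)" "\<And>x. x \<in> vecs X \<Longrightarrow> \<bar>f x\<bar> \<le> nrm X x" "f x = nrm X x"
    using norming_functional[OF X x] by blast
  have "nrm (dual X) f \<le> 1" using f by (intro nrm_dual_le[OF X]) auto
  from le[OF f(1) this] f(3) show ?thesis by simp
qed

text \<open>A uniform bound on the absolute partial sums at each vector replaces convergence in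
  norm. The gliding hump for \<open>p = 1\<close> depends on this, since the norms of its
  functionals do not tend to \<open>0\<close>.\<close>

lemma suminf_in_dual:
  assumes X: "normed_space X" and g: "\<And>i::nat. g i \<in> vecs (dual X)"
    and bound: "\<And>x k. x \<in> vecs X \<Longrightarrow> (\<Sum>i<k. \<bar>g i x\<bar>) \<le> C * nrm X x"
  shows "(\<lambda>x. \<Sum>i. g i x) \<in> vecs (dual X)"
    and "\<And>x. x \<in> vecs X \<Longrightarrow> summable (\<lambda>i. \<bar>g i x\<bar>)"
proof -
  show abs: "summable (\<lambda>i. \<bar>g i x\<bar>)" if "x \<in> vecs X" for x
    using bound[OF that] by (intro summableI_nonneg_bounded) auto
  have s: "summable (\<lambda>i. g i x)" if "x \<in> vecs X" for x
    by (rule summable_rabs_cancel[OF abs[OF that]])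
  show "(\<lambda>x. \<Sum>i. g i x) \<in> vecs (dual X)"
  proof (rule dualI[where C = C])
    fix x assume x: "x \<in> vecs X"
    have "\<bar>\<Sum>i. g i x\<bar> \<le> (\<Sum>i. \<bar>g i x\<bar>)" by (rule summable_rabs[OF abs[OF x]])
    also have "\<dots> \<le> C * nrm X x" by (intro suminf_le_const abs[OF x] bound[OF x])
    finally show "\<bar>\<Sum>i. g i x\<bar> \<le> C * nrm X x" .
  next
    fix x y assume "x \<in> vecs X" "y \<in> vecs X"
    thus "(\<Sum>i. g i (x + y)) = (\<Sum>i. g i x) + (\<Sum>i. g i y)"
      using suminf_add[OF s s, of x y] by (simp add: dual_add[OF g])
  next
    fix c x assume "x \<in> vecs X"
    thus "(\<Sum>i. g i (c *\<^sub>R x)) = c * (\<Sum>i. g i x)"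
      using suminf_mult[OF s, of x c] by (simp add: dual_scale[OF g])
  qed (simp add: dual_outside[OF g])
qed

text \<open>Sokal's gliding hump for the uniform boundedness principle: the signs are chosen so that the
  \<open>n\<close>-th partial sum of the functional is large at \<open>x n\<close>, and the remaining terms cannot cancel it.\<close>

lemma weakly_bounded_imp_bounded:
  assumes X: "normed_space X" and A: "A \<subseteq> vecs X"
    and weak: "\<And>f. f \<in> vecs (dual X) \<Longrightarrow> \<exists>b. \<forall>x\<in>A. \<bar>f x\<bar> \<le> b"
  shows "\<exists>m. \<forall>x\<in>A. nrm X x \<le> m"
proof (rule ccontr)
  assume "\<not> ?thesis"
  \<comment> \<open>\<open>4 ^ n\<close> is set against the weights \<open>(1/3) ^ i\<close>: the
    \<open>n\<close>-th weighted term at \<open>x n\<close> exceeds \<open>(4/3) ^ n\<close>, which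
    is unbounded, while all later weights together amount to half of the \<open>n\<close>-th
    one.\<close>
  hence "\<forall>n::nat. \<exists>x\<in>A. 4 ^ n < nrm X x" by (meson not_le)
  then obtain x where xA: "\<And>n. x n \<in> A" and big: "\<And>n::nat. 4 ^ n < nrm X (x n)" by metis
  have x: "x n \<in> vecs X" for n using xA A by blast
  have "\<exists>f. f \<in> vecs (dual X) \<and> (\<forall>y\<in>vecs X. \<bar>f y\<bar> \<le> nrm X y) \<and> f (x n) = nrm X (x n)" for n
    using norming_functional[OF X x[of n]] by metis
  then obtain \<phi> where \<phi>: "\<And>n. \<phi> n \<in> vecs (dual X)"
    and \<phi>_le: "\<And>n y. y \<in> vecs X \<Longrightarrow> \<bar>\<phi> n y\<bar> \<le> nrm X y"
    and \<phi>_x: "\<And>n. \<phi> n (x n) = nrm X (x n)"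
    by metis
  define h where "h s i y = s * (1/3) ^ i * \<phi> i y" for s :: real and i y
  \<comment> \<open>Adding a term with the sign of the previous partial sum cannot decrease its
    absolute value below that of the term. The condition on \<open>s n\<close> involves earlier
    signs only, so the choice is recursive.\<close>
  have "\<exists>s. \<forall>n. (s n = 1 \<or> s n = -1) \<and>
          (1/3) ^ n * nrm X (x n) \<le> \<bar>(\<Sum>i<n. h (s i) i (x n)) + h (s n) n (x n)\<bar>"
  proof (rule dependent_wellorder_choice)
    fix r :: real and s t :: "nat \<Rightarrow> real" and n :: nat
    assume "\<And>i. i < n \<Longrightarrow> s i = t i"
    hence "(\<Sum>i<n. h (s i) i (x n)) = (\<Sum>i<n. h (t i) i (x n))" by simp
    thus "((r = 1 \<or> r = -1) \<and> (1/3) ^ n * nrm X (x n) \<le> \<bar>(\<Sum>i<n. h (s i) i (x n)) + h r n (x n)\<bar>) =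
          ((r = 1 \<or> r = -1) \<and> (1/3) ^ n * nrm X (x n) \<le> \<bar>(\<Sum>i<n. h (t i) i (x n)) + h r n (x n)\<bar>)"
      by simp
  next
    fix n :: nat and s :: "nat \<Rightarrow> real"
    let ?S = "\<Sum>i<n. h (s i) i (x n)"
    show "\<exists>r. (r = 1 \<or> r = -1) \<and> (1/3) ^ n * nrm X (x n) \<le> \<bar>?S + h r n (x n)\<bar>"
    proof (cases "0 \<le> ?S")
      case True
      thus ?thesis by (intro exI[of _ 1]) (auto simp: h_def \<phi>_x)
    next
      case False
      thus ?thesis by (intro exI[of _ "-1"]) (auto simp: h_def \<phi>_x)
    qed
  qed
  then obtain s :: "nat \<Rightarrow> real" where s: "\<And>n. s n = 1 \<or> s n = -1"
    and large: "\<And>n. (1/3) ^ n * nrm X (x n) \<le> \<bar>(\<Sum>i<n. h (s i) i (x n)) + h (s n) n (x n)\<bar>"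
    by blast
  define g where "g i = (s i * (1/3) ^ i) *\<^sub>R \<phi> i" for i
  have g_apply: "g i y = h (s i) i y" for i y by (simp add: g_def h_def scaleR_fun_apply)
  have g: "g i \<in> vecs (dual X)" for i
    unfolding g_def using vecs_scale[OF normed_space_dual[OF X] \<phi>] .
  have g_le: "\<bar>g i y\<bar> \<le> (1/3) ^ i * nrm X y" if "y \<in> vecs X" for i y
    using \<phi>_le[OF that, of i] s[of i] by (auto simp: g_apply h_def abs_mult)
  have sum_le: "(\<Sum>i<k. \<bar>g i y\<bar>) \<le> (3/2) * nrm X y" if y: "y \<in> vecs X" for k y
  proof -
    have "(\<Sum>i<k. \<bar>g i y\<bar>) \<le> (\<Sum>i<k. (1/3) ^ i * nrm X y)" by (intro sum_mono g_le y)
    also have "\<dots> = (\<Sum>i<k. (1/3) ^ i) * nrm X y" by (simp add: sum_distrib_right)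
    also have "(\<Sum>i<k. (1/3) ^ i) \<le> (\<Sum>i. (1/3::real) ^ i)" by (intro sum_le_suminf) auto
    hence "(\<Sum>i<k. (1/3) ^ i) * nrm X y \<le> (3/2) * nrm X y"
      using nrm_nonneg[OF X y] by (intro mult_right_mono) (auto simp: suminf_geometric)
    finally show ?thesis .
  qed
  let ?f = "\<lambda>y. \<Sum>i. g i y"
  have f: "?f \<in> vecs (dual X)" by (rule suminf_in_dual(1)[OF X g sum_le])
  have sm: "summable (\<lambda>i. g i y)" if "y \<in> vecs X" for y
    using suminf_in_dual(2)[OF X g sum_le that] by (rule summable_rabs_cancel)
  obtain b where b: "\<And>y. y \<in> A \<Longrightarrow> \<bar>?f y\<bar> \<le> b" using weak[OF f] by blast
  have low: "(4/3) ^ n \<le> 2 * b" for n :: nat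
  proof -
    let ?N = "nrm X (x n)"
    have "norm (\<Sum>i. g (i + Suc n) (x n)) \<le> (\<Sum>i. (1/3) ^ i * ((1/3) ^ Suc n * ?N))"
    proof (rule norm_suminf_le)
      fix i
      show "norm (g (i + Suc n) (x n)) \<le> (1/3) ^ i * ((1/3) ^ Suc n * ?N)"
        using g_le[OF x, of "i + Suc n" n] by (simp only: real_norm_def power_add mult.assoc)
    qed (intro summable_mult2, simp)
    hence "\<bar>\<Sum>i. g (i + Suc n) (x n)\<bar> \<le> (\<Sum>i. (1/3) ^ i * ((1/3) ^ Suc n * ?N))" by simp
    also have "\<dots> = (1/3) ^ n * ?N / 2"
      by (subst suminf_mult2[symmetric]) (auto simp: suminf_geometric)
    finally have tail: "\<bar>\<Sum>i. g (i + Suc n) (x n)\<bar> \<le> (1/3) ^ n * ?N / 2" .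
    have "?f (x n) = (\<Sum>i. g (i + Suc n) (x n)) + (\<Sum>i<Suc n. g i (x n))"
      by (rule suminf_split_initial_segment[OF sm[OF x]])
    moreover have "(1/3) ^ n * ?N \<le> \<bar>\<Sum>i<Suc n. g i (x n)\<bar>"
      using large[of n] by (simp add: g_apply)
    ultimately have "(1/3) ^ n * ?N \<le> 2 * \<bar>?f (x n)\<bar>" using tail by linarith
    moreover have "(1/3) ^ n * 4 ^ n \<le> (1/3) ^ n * ?N" using big[of n] by simp
    ultimately show ?thesis using b[OF xA[of n]] by (simp add: power_mult_distrib[symmetric])
  qed
  obtain n where "2 * b < (4/3) ^ n" using real_arch_pow[of "4/3" "2 * b"] by auto
  with low[of n] show False by simp
qed

subsection \<open>The weak* topology\<close>

lemma topspace_weak_star: "topspace (weak_star X) = vecs (dual X)"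
  by (auto simp: weak_star_def topspace_pullback_topology)

lemma continuous_map_weak_star_eval:
  assumes "x \<in> vecs X"
  shows "continuous_map (weak_star X) euclideanreal (\<lambda>f. f x)"
proof -
  have "continuous_map (product_topology (\<lambda>x. euclideanreal) (vecs X)) euclideanreal (\<lambda>f. f x)"
    using assms by (rule continuous_map_product_projection)
  from continuous_map_pullback[OF this, of "vecs (dual X)" "\<lambda>f. restrict f (vecs X)"]
  show ?thesis using assms by (simp add: weak_star_def o_def)
qed

lemma continuous_map_into_weak_star:
  assumes "\<And>t. t \<in> topspace T \<Longrightarrow> g t \<in> vecs (dual X)"
    and "\<And>x. x \<in> vecs X \<Longrightarrow> continuous_map T euclideanreal (\<lambda>t. g t x)"
  shows "continuous_map T (weak_star X) g"
  unfolding weak_star_def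
  by (rule continuous_map_pullback')
    (use assms in \<open>auto simp: continuous_map_componentwise o_def\<close>)

text \<open>Restriction to \<open>vecs X\<close> is injective because members of the dual vanish
  elsewhere. The property serves to turn compact sets into closed ones that can be pulled
  back.\<close>

lemma Hausdorff_weak_star: "Hausdorff_space (weak_star X)"
proof (rule Hausdorff_space_injective_preimage)
  show "Hausdorff_space (product_topology (\<lambda>x. euclideanreal) (vecs X))"
    by (simp add: Hausdorff_space_product_topology)
  show "continuous_map (weak_star X) (product_topology (\<lambda>x. euclideanreal) (vecs X))
          (\<lambda>f. restrict f (vecs X))"
    by (simp add: continuous_map_componentwise image_subset_iff continuous_map_weak_star_eval)
  show "inj_on (\<lambda>f. restrict f (vecs X)) (topspace (weak_star X))"
  proof (rule inj_onI)
    fix f g assume "f \<in> topspace (weak_star X)" "g \<in> topspace (weak_star X)"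
      and eq: "restrict f (vecs X) = restrict g (vecs X)"
    hence "f \<in> vecs (dual X)" "g \<in> vecs (dual X)" by (auto simp: topspace_weak_star)
    thus "f = g"
      using fun_cong[OF eq] dual_outside[of _ X] by (intro ext) (metis restrict_apply')
  qed
qed

text \<open>Tychonoff's theorem for a product of intervals; linearity cuts out a closed subset,
  since each of its instances involves finitely many coordinates.\<close>

theorem Banach_Alaoglu:
  assumes X: "normed_space X" and C: "0 \<le> C"
  shows "compactin (weak_star X) {f \<in> vecs (dual X). nrm (dual X) f \<le> C}"
proof -
  let ?V = "vecs X" and ?P = "product_topology (\<lambda>x. euclideanreal) (vecs X)"
  define Q where "Q = (\<Pi>\<^sub>E x\<in>?V. {- (C * nrm X x) .. C * nrm X x})"
  define Q' where "Q' = Q \<inter> ((\<Inter>x\<in>?V. \<Inter>y\<in>?V. {g \<in> topspace ?P. g (x + y) - g x - g y \<in> {0}}) \<inter>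
      (\<Inter>c. \<Inter>x\<in>?V. {g \<in> topspace ?P. g (c *\<^sub>R x) - c * g x \<in> {0}}))"
  have Q: "compactin ?P Q" unfolding Q_def by (simp add: compactin_PiE)
  have ne: "?V \<noteq> {}" using vecs_zero[OF X] by blast
  have proj: "continuous_map ?P euclideanreal (\<lambda>g. g x)" if "x \<in> ?V" for x
    using that by (rule continuous_map_product_projection)
  have "compactin ?P Q'"
    unfolding Q'_def
  proof (rule compact_Int_closedin[OF Q closedin_Int])
    show "closedin ?P (\<Inter>x\<in>?V. \<Inter>y\<in>?V. {g \<in> topspace ?P. g (x + y) - g x - g y \<in> {0}})"
      using ne
      by (intro closedin_INT closedin_continuous_map_preimage[where Y = euclideanreal]
          continuous_map_diff proj vecs_add[OF X]) auto
    show "closedin ?P (\<Inter>c. \<Inter>x\<in>?V. {g \<in> topspace ?P. g (c *\<^sub>R x) - c * g x \<in> {0}})"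
      using ne
      by (intro closedin_INT closedin_continuous_map_preimage[where Y = euclideanreal]
          continuous_map_diff continuous_map_real_mult_left proj vecs_scale[OF X]) auto
  qed
  \<comment> \<open>Points of the product are \<open>undefined\<close> off \<open>vecs X\<close>,
    members of the dual are \<open>0\<close> there. The map \<open>e\<close> passes between the two
    conventions and is continuous into the weak* topology.\<close>
  define e where "e g = (\<lambda>x. if x \<in> ?V then g x else 0)" for g :: "'a \<Rightarrow> real"
  have Q'_D: "\<bar>g x\<bar> \<le> C * nrm X x" "g (x + y) = g x + g y" "g (c *\<^sub>R x) = c * g x"
    if "g \<in> Q'" "x \<in> ?V" "y \<in> ?V" for g x y c
    using that by (auto simp: Q'_def Q_def PiE_iff abs_le_iff algebra_simps)
  have e_dual: "e g \<in> vecs (dual X)" if "g \<in> Q'" for g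
    using Q'_D[OF that] X by (intro dualI[where C = C]) (auto simp: e_def vecs_add vecs_scale)
  have "compactin (weak_star X) (e ` Q')"
  proof (rule image_compactin)
    show "compactin (subtopology ?P Q') Q'"
      using \<open>compactin ?P Q'\<close> by (simp add: compactin_subtopology)
    show "continuous_map (subtopology ?P Q') (weak_star X) e"
      by (rule continuous_map_into_weak_star)
        (use e_dual in \<open>auto simp: e_def intro!: continuous_map_from_subtopology proj\<close>)
  qed
  also have "e ` Q' = {f \<in> vecs (dual X). nrm (dual X) f \<le> C}"
  proof (intro equalityI subsetI)
    fix f assume "f \<in> e ` Q'"
    then obtain g where g: "g \<in> Q'" "f = e g" by blast
    have "nrm (dual X) f \<le> C"
      using Q'_D(1)[OF g(1)] by (intro nrm_dual_le[OF X C]) (auto simp: g(2) e_def)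
    thus "f \<in> {f \<in> vecs (dual X). nrm (dual X) f \<le> C}" using e_dual g by simp
  next
    fix f assume f: "f \<in> {f \<in> vecs (dual X). nrm (dual X) f \<le> C}"
    hence le: "\<bar>f x\<bar> \<le> C * nrm X x" if "x \<in> ?V" for x
      using dual_le_const[OF X _ _ that] by blast
    have "restrict f ?V \<in> Q'"
      using f le X by (auto simp: Q'_def Q_def abs_le_iff dual_add dual_scale vecs_add vecs_scale
          minus_le_iff)
    moreover have "f = e (restrict f ?V)"
      using f dual_outside[of f X] by (auto simp: e_def fun_eq_iff)
    ultimately show "f \<in> e ` Q'" by blast
  qed
  finally show ?thesis .
qed

section \<open>Weakly compact sets: boundedness and cluster points\<close>

lemma compactin_embedded_imp_bounded:
  assumes X: "normed_space X" and A: "A \<subseteq> vecs X"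
    and cpt: "compactin (weak_star (dual X)) (canonical_embedding X ` A)"
  shows "\<exists>m. \<forall>x\<in>A. nrm X x \<le> m"
proof (rule weakly_bounded_imp_bounded[OF X A])
  fix f assume f: "f \<in> vecs (dual X)"
  \<comment> \<open>Evaluation at \<open>f\<close> is weak* continuous, so its values on the compact
    set form a compact set of reals.\<close>
  have "compact ((\<lambda>z. z f) ` canonical_embedding X ` A)"
    using image_compactin[OF cpt continuous_map_weak_star_eval[OF f]] by simp
  hence "bounded ((\<lambda>z. z f) ` canonical_embedding X ` A)" by (rule compact_imp_bounded)
  thus "\<exists>b. \<forall>x\<in>A. \<bar>f x\<bar> \<le> b"
    using f by (auto simp: bounded_iff canonical_embedding_apply)
qed

text \<open>Otherwise each point of \<open>L\<close> has a neighbourhood that the sequence avoids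
  from some index on; finitely many of these cover \<open>L\<close>, and at the largest of the
  indices the sequence has no place left.\<close>

lemma compactin_imp_cluster_point:
  fixes w :: "nat \<Rightarrow> 'a"
  assumes L: "compactin T L" and w: "\<And>n. w n \<in> L"
  obtains z where "z \<in> L" "\<And>U N. openin T U \<Longrightarrow> z \<in> U \<Longrightarrow> \<exists>n\<ge>N. w n \<in> U"
proof (rule ccontr)
  assume "\<not> thesis"
  with that have "\<forall>z\<in>L. \<exists>U N. openin T U \<and> z \<in> U \<and> (\<forall>n\<ge>N. w n \<notin> U)" by meson
  then obtain U N where U: "\<And>z. z \<in> L \<Longrightarrow> openin T (U z)" "\<And>z. z \<in> L \<Longrightarrow> z \<in> U z"
    and N: "\<And>z n. z \<in> L \<Longrightarrow> N z \<le> n \<Longrightarrow> w n \<notin> U z" by metis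
  have "(\<forall>V\<in>U ` L. openin T V) \<and> L \<subseteq> \<Union>(U ` L)" using U by blast
  hence "\<exists>\<F>. finite \<F> \<and> \<F> \<subseteq> U ` L \<and> L \<subseteq> \<Union>\<F>"
    using L unfolding compactin_def by simp
  then obtain Z where Z: "finite Z" "Z \<subseteq> L" "L \<subseteq> \<Union>(U ` Z)"
    by (metis finite_subset_image)
  obtain z where z: "z \<in> Z" "w (Max (insert 0 (N ` Z))) \<in> U z" using w Z(3) by blast
  moreover have "N z \<le> Max (insert 0 (N ` Z))" using Z(1) z(1) by simp
  ultimately show False using N Z(2) by blast
qed

text \<open>Basic weak* neighbourhoods restrict finitely many evaluations. Cluster points are used
  because a sequence in a weak* compact set need not have a convergent subsequence.\<close>

lemma weak_star_cluster_point:
  fixes w :: "nat \<Rightarrow> 'a::real_vector \<Rightarrow> real"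
  assumes L: "compactin (weak_star X) L" and w: "\<And>n. w n \<in> L"
  obtains z where "z \<in> L"
    "\<And>F e N. finite F \<Longrightarrow> F \<subseteq> vecs X \<Longrightarrow> 0 < e \<Longrightarrow> \<exists>n\<ge>N. \<forall>x\<in>F. \<bar>w n x - z x\<bar> < e"
proof -
  obtain z where z: "z \<in> L"
    "\<And>U N. openin (weak_star X) U \<Longrightarrow> z \<in> U \<Longrightarrow> \<exists>n\<ge>N. w n \<in> U"
    by (rule compactin_imp_cluster_point[OF L, of w]) (use w in auto)
  have zd: "z \<in> topspace (weak_star X)" using z(1) L compactin_subset_topspace by blast
  show thesis
  proof (rule that[OF z(1)])
    fix F :: "'a set" and e :: real and N
    assume F: "finite F" "F \<subseteq> vecs X" and e: "0 < e"
    \<comment> \<open>Intersecting with the whole space keeps \<open>U\<close> open for empty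
      \<open>F\<close>, where the intersection over \<open>F\<close> is \<open>UNIV\<close>.\<close>
    define U where "U = topspace (weak_star X) \<inter>
      (\<Inter>x\<in>F. {f \<in> topspace (weak_star X). f x \<in> {z x - e <..< z x + e}})"
    have "openin (weak_star X) U"
      unfolding U_def
    proof (cases "F = {}")
      case False
      have "openin (weak_star X) (\<Inter>x\<in>F. {f \<in> topspace (weak_star X). f x \<in> {z x - e <..< z x + e}})"
        using F False
        by (intro openin_INT2 openin_continuous_map_preimage[where Y = euclideanreal]
            continuous_map_weak_star_eval) auto
      thus "openin (weak_star X) (topspace (weak_star X) \<inter>
          (\<Inter>x\<in>F. {f \<in> topspace (weak_star X). f x \<in> {z x - e <..< z x + e}}))"
        by (intro openin_Int) auto
    qed auto
    moreover have "z \<in> U" using zd e by (auto simp: U_def)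
    ultimately obtain n where "n \<ge> N" "w n \<in> U" using z(2) by blast
    thus "\<exists>n\<ge>N. \<forall>x\<in>F. \<bar>w n x - z x\<bar> < e"
      by (intro exI[of _ n]) (auto simp: U_def abs_less_iff algebra_simps)
  qed
qed

subsection \<open>The \<open>\<ell>\<^sub>p\<close>-sum as a Banach space\<close>

lemma powr_le_powr_iff:
  fixes a b p :: real
  assumes "0 \<le> a" "0 \<le> b" "0 < p"
  shows "a powr p \<le> b powr p \<longleftrightarrow> a \<le> b"
  using assms powr_mono2[of p a b] powr_less_mono2[of p b a] by linarith

text \<open>Convexity of the power is applied to positive arguments; if one argument vanishes, the
  claim reduces to \<open>r powr p \<le> r\<close> for \<open>0 \<le> r \<le> 1\<close>.\<close>

lemma powr_convex_nonneg:
  fixes u v s t p :: real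
  assumes p: "1 \<le> p" and uv: "0 \<le> u" "0 \<le> v" and st: "0 \<le> s" "0 \<le> t" "s + t = 1"
  shows "(s * u + t * v) powr p \<le> s * u powr p + t * v powr p"
proof -
  have scale: "(r * w) powr p \<le> r * w powr p" if "0 \<le> r" "r \<le> 1" "0 \<le> w" for r w :: real
  proof (cases "r = 0")
    case False
    hence "r powr p \<le> r" using that p by (intro powr_le_one_le) auto
    thus ?thesis by (simp add: powr_mult mult_right_mono)
  qed simp
  show ?thesis
  proof (cases "u = 0 \<or> v = 0")
    case True
    thus ?thesis using scale[of s u] scale[of t v] st uv by auto
  next
    case False
    thus ?thesis
      using convex_onD[OF powr_convex[OF p], of t u v] uv st by (simp add: eq_diff_eq[symmetric])
  qed
qed

text \<open>Minkowski's inequality, from convexity of \<open>x \<mapsto> x powr p\<close> at the convex combination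
  \<open>(a + b) / (A + B) = A / (A + B) * (a / A) + B / (A + B) * (b / B)\<close>.\<close>

lemma Minkowski_sum:
  fixes a b :: "'i \<Rightarrow> real"
  assumes p: "1 \<le> p" and ab: "\<And>i. i \<in> I \<Longrightarrow> 0 \<le> a i" "\<And>i. i \<in> I \<Longrightarrow> 0 \<le> b i"
    and AB: "0 \<le> A" "0 \<le> B"
    and a: "(\<Sum>i\<in>I. a i powr p) \<le> A powr p" and b: "(\<Sum>i\<in>I. b i powr p) \<le> B powr p"
  shows "(\<Sum>i\<in>I. (a i + b i) powr p) \<le> (A + B) powr p"
proof (cases "finite I")
  case True
  \<comment> \<open>For \<open>A = 0\<close> or \<open>B = 0\<close> the division by the bound is
    impossible, but then all terms of that family vanish.\<close>
  have vanish: "c i = 0" if "(\<Sum>i\<in>I. c i powr p) \<le> 0" "i \<in> I" for c :: "'i \<Rightarrow> real" and i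
    using that True sum_nonneg_eq_0_iff[of I "\<lambda>i. c i powr p"] sum_nonneg[of I "\<lambda>i. c i powr p"]
    by (metis order_antisym powr_eq_0_iff powr_ge_zero)
  consider "A = 0" | "B = 0" | "0 < A" "0 < B" using AB by linarith
  thus ?thesis
  proof cases
    case 1
    thus ?thesis using vanish[of a] a b by simp
  next
    case 2
    thus ?thesis using vanish[of b] a b by simp
  next
    case 3
    define s where "s = A / (A + B)"
    define t where "t = B / (A + B)"
    have st: "0 \<le> s" "0 \<le> t" "s + t = 1" using 3 by (auto simp: s_def t_def add_divide_distrib[symmetric])
    have "(a i + b i) powr p \<le> (A + B) powr p * (s * (a i / A) powr p + t * (b i / B) powr p)"
      if i: "i \<in> I" for i
    proof -
      have "a i + b i = (A + B) * (s * (a i / A) + t * (b i / B))"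
        using 3 by (simp add: s_def t_def distrib_left)
      hence "(a i + b i) powr p = (A + B) powr p * (s * (a i / A) + t * (b i / B)) powr p"
        by (simp add: powr_mult)
      also have "\<dots> \<le> (A + B) powr p * (s * (a i / A) powr p + t * (b i / B) powr p)"
        using ab[OF i] 3 by (intro mult_left_mono powr_convex_nonneg[OF p _ _ st]) auto
      finally show ?thesis .
    qed
    hence "(\<Sum>i\<in>I. (a i + b i) powr p)
        \<le> (\<Sum>i\<in>I. (A + B) powr p * (s * (a i / A) powr p + t * (b i / B) powr p))"
      by (rule sum_mono)
    also have "\<dots> = (A + B) powr p * (s * ((\<Sum>i\<in>I. a i powr p) / A powr p)
        + t * ((\<Sum>i\<in>I. b i powr p) / B powr p))"
      using 3 by (simp add: sum_distrib_left[symmetric] sum.distrib sum_divide_distrib[symmetric]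
          powr_divide times_divide_eq_right[symmetric] del: times_divide_eq_right)
    also have "\<dots> \<le> (A + B) powr p * (s * 1 + t * 1)"
      using a b 3 st by (intro mult_left_mono add_mono) auto
    finally show ?thesis using st by simp
  qed
qed simp

text \<open>\<open>block {N..}\<close> is the tail operator \<open>T\<^sub>N\<close>, and
  \<open>block {..<N}\<close> is the complementary head projection.\<close>

definition block :: "nat set \<Rightarrow> (nat \<Rightarrow> 'a) \<Rightarrow> nat \<Rightarrow> 'a::zero" where
  "block A x = (\<lambda>n. if n \<in> A then x n else 0)"

definition single :: "nat \<Rightarrow> 'a \<Rightarrow> nat \<Rightarrow> 'a::zero" where
  "single n a = (\<lambda>m. if m = n then a else 0)"

lemma block_block: "block A (block B x) = block (A \<inter> B) x"
  by (auto simp: block_def)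

lemma sum_single_eq_block:
  fixes x :: "nat \<Rightarrow> 'a::comm_monoid_add"
  shows "(\<Sum>n<N. single n (x n)) = block {..<N} x"
proof (induction N)
  case 0
  show ?case by (simp add: block_def fun_eq_iff)
next
  case (Suc N)
  thus ?case by (auto simp: block_def single_def fun_eq_iff less_Suc_eq)
qed

locale lp_sequence =
  fixes X :: "nat \<Rightarrow> 'a::real_vector nspace" and p :: real
  assumes normed: "\<And>n. normed_space (X n)" and p: "1 \<le> p"
begin

abbreviation S :: "(nat \<Rightarrow> 'a) nspace" where "S \<equiv> lp_sum p X"

definition pwr :: "(nat \<Rightarrow> 'a) \<Rightarrow> nat \<Rightarrow> real" where "pwr x n = nrm (X n) (x n) powr p"

lemma p_pos: "0 < p" using p by simp

lemma pwr_nonneg: "0 \<le> pwr x n" by (simp add: pwr_def)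

lemma vecs_iff: "x \<in> vecs S \<longleftrightarrow> (\<forall>n. x n \<in> vecs (X n)) \<and> summable (pwr x)"
  by (simp add: lp_sum_def pwr_def[abs_def])

lemma coord: "x \<in> vecs S \<Longrightarrow> x n \<in> vecs (X n)"
  by (simp add: vecs_iff)

lemma pwr_summable: "x \<in> vecs S \<Longrightarrow> summable (pwr x)"
  by (simp add: vecs_iff)

lemma nrm_eq: "nrm S x = (\<Sum>n. pwr x n) powr (1 / p)"
  by (simp add: lp_sum_def pwr_def)

lemma nrm_ge_0: "0 \<le> nrm S x"
  by (simp add: nrm_eq)

lemma nrm_powr: "x \<in> vecs S \<Longrightarrow> nrm S x powr p = (\<Sum>n. pwr x n)"
  using p suminf_nonneg[OF pwr_summable pwr_nonneg, of x] by (simp add: nrm_eq powr_powr)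

lemma sum_pwr_le: "x \<in> vecs S \<Longrightarrow> finite I \<Longrightarrow> sum (pwr x) I \<le> nrm S x powr p"
  by (simp add: nrm_powr sum_le_suminf pwr_summable pwr_nonneg)

text \<open>Reduces membership and the norm bound together to finite partial sums, where limits and
  inequalities can be handled coordinate by coordinate.\<close>

lemma in_lp_sumI:
  assumes x: "\<And>n. x n \<in> vecs (X n)" and C: "0 \<le> C" "\<And>k. sum (pwr x) {..<k} \<le> C powr p"
  shows "x \<in> vecs S" "nrm S x \<le> C"
proof -
  show S: "x \<in> vecs S"
    unfolding vecs_iff using x summableI_nonneg_bounded[OF pwr_nonneg C(2)] by blast
  have "nrm S x powr p \<le> C powr p"
    unfolding nrm_powr[OF S] by (rule suminf_le_const[OF pwr_summable[OF S] C(2)])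
  thus "nrm S x \<le> C" using powr_le_powr_iff[OF nrm_ge_0 C(1) p_pos] by simp
qed

lemma nrm_coord_le:
  assumes "x \<in> vecs S"
  shows "nrm (X n) (x n) \<le> nrm S x"
  using sum_pwr_le[OF assms, of "{n}"] nrm_nonneg[OF normed coord[OF assms]] p_pos
  by (simp add: pwr_def powr_le_powr_iff nrm_ge_0)

lemma add_in_lp_sum:
  assumes x: "x \<in> vecs S" and y: "y \<in> vecs S"
  shows "x + y \<in> vecs S" "nrm S (x + y) \<le> nrm S x + nrm S y"
proof -
  have "sum (pwr (x + y)) {..<k} \<le> (nrm S x + nrm S y) powr p" for k
  proof -
    have "sum (pwr (x + y)) {..<k} \<le> (\<Sum>n<k. (nrm (X n) (x n) + nrm (X n) (y n)) powr p)"
      unfolding pwr_def plus_fun_apply using coord[OF x] coord[OF y] normed p_pos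
      by (intro sum_mono powr_mono2 nrm_triangle nrm_nonneg vecs_add) auto
    also have "\<dots> \<le> (nrm S x + nrm S y) powr p"
      using sum_pwr_le[OF x, of "{..<k}"] sum_pwr_le[OF y, of "{..<k}"] nrm_nonneg[OF normed]
        coord[OF x] coord[OF y]
      by (intro Minkowski_sum[OF p]) (auto simp: nrm_ge_0 pwr_def)
    finally show ?thesis .
  qed
  from in_lp_sumI[OF _ _ this] show "x + y \<in> vecs S" "nrm S (x + y) \<le> nrm S x + nrm S y"
    using coord[OF x] coord[OF y] by (simp_all add: nrm_ge_0 vecs_add[OF normed])
qed

lemma scale_in_lp_sum:
  assumes x: "x \<in> vecs S"
  shows "c *\<^sub>R x \<in> vecs S" "nrm S (c *\<^sub>R x) = \<bar>c\<bar> * nrm S x"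
proof -
  have pwr: "pwr (c *\<^sub>R x) n = \<bar>c\<bar> powr p * pwr x n" for n
    using nrm_scale[OF normed coord[OF x]] by (simp add: pwr_def scaleR_fun_apply powr_mult)
  show S: "c *\<^sub>R x \<in> vecs S"
    using coord[OF x] summable_mult[OF pwr_summable[OF x]]
    by (simp add: vecs_iff ext[of "pwr (c *\<^sub>R x)", OF pwr] scaleR_fun_apply vecs_scale[OF normed])
  have "nrm S (c *\<^sub>R x) powr p = (\<bar>c\<bar> * nrm S x) powr p"
    using pwr_summable[OF x] by (simp add: nrm_powr S x pwr powr_mult suminf_mult)
  thus "nrm S (c *\<^sub>R x) = \<bar>c\<bar> * nrm S x"
    using powr_le_powr_iff[OF _ _ p_pos, of "nrm S (c *\<^sub>R x)" "\<bar>c\<bar> * nrm S x"]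
      powr_le_powr_iff[OF _ _ p_pos, of "\<bar>c\<bar> * nrm S x" "nrm S (c *\<^sub>R x)"]
      nrm_ge_0[of x] nrm_ge_0[of "c *\<^sub>R x"] by auto
qed

lemma zero_in_lp_sum: "0 \<in> vecs S" "nrm S 0 = 0"
proof -
  have "pwr 0 = (\<lambda>n. 0)" by (simp add: pwr_def fun_eq_iff nrm_zero[OF normed])
  thus "0 \<in> vecs S" "nrm S 0 = 0" by (simp_all add: vecs_iff nrm_eq vecs_zero[OF normed])
qed

lemma normed_space_lp_sum: "normed_space S"
  unfolding normed_space_def
proof (intro conjI ballI allI)
  show "subspace (vecs S)"
    using zero_in_lp_sum(1) add_in_lp_sum(1) scale_in_lp_sum(1) by (intro subspaceI) auto
  fix x assume x: "x \<in> vecs S"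
  show "0 \<le> nrm S x" by (rule nrm_ge_0)
  show "nrm S x = 0 \<longleftrightarrow> x = 0"
  proof
    assume "nrm S x = 0"
    hence "nrm (X n) (x n) = 0" for n
      using nrm_coord_le[OF x, of n] nrm_nonneg[OF normed coord[OF x], of n] by simp
    thus "x = 0" using nrm_eq_0[OF normed coord[OF x]] by (simp add: fun_eq_iff)
  qed (simp add: zero_in_lp_sum)
  fix c show "nrm S (c *\<^sub>R x) = \<bar>c\<bar> * nrm S x" by (rule scale_in_lp_sum(2)[OF x])
next
  fix x y assume "x \<in> vecs S" "y \<in> vecs S"
  thus "nrm S (x + y) \<le> nrm S x + nrm S y" by (rule add_in_lp_sum(2))
qed

lemmas S_add = vecs_add[OF normed_space_lp_sum]
  and S_diff = vecs_diff[OF normed_space_lp_sum]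

text \<open>The coordinatewise limit is the only candidate. The Cauchy estimate passes to the limit
  in partial sums over finitely many coordinates, with a bound that does not depend on their
  number.\<close>

lemma banach_space_lp_sum:
  assumes banach: "\<And>n. banach_space (X n)"
  shows "banach_space S"
  unfolding banach_space_def
proof (intro conjI normed_space_lp_sum allI impI)
  fix \<sigma> :: "nat \<Rightarrow> nat \<Rightarrow> 'a"
  assume \<sigma>: "\<forall>m. \<sigma> m \<in> vecs S" and cauchy: "\<forall>e>0. \<exists>M. \<forall>m\<ge>M. \<forall>k\<ge>M. nrm S (\<sigma> m - \<sigma> k) < e"
  have \<sigma>S: "\<sigma> m \<in> vecs S" for m using \<sigma> by blast
  note \<sigma>X = coord[OF \<sigma>S]
  have "\<exists>x\<in>vecs (X n). (\<lambda>m. nrm (X n) (\<sigma> m n - x)) \<longlonglongrightarrow> 0" for n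
  proof -
    have "\<exists>M. \<forall>m\<ge>M. \<forall>k\<ge>M. nrm (X n) (\<sigma> m n - \<sigma> k n) < e" if "0 < e" for e
    proof -
      obtain M where "\<forall>m\<ge>M. \<forall>k\<ge>M. nrm S (\<sigma> m - \<sigma> k) < e" using cauchy \<open>0 < e\<close> by blast
      moreover have "nrm (X n) (\<sigma> m n - \<sigma> k n) \<le> nrm S (\<sigma> m - \<sigma> k)" for m k
        using nrm_coord_le[OF S_diff[OF \<sigma>S \<sigma>S], of n m k] by simp
      ultimately show ?thesis by (meson le_less_trans)
    qed
    hence "\<forall>e>0. \<exists>M. \<forall>m\<ge>M. \<forall>k\<ge>M. nrm (X n) (\<sigma> m n - \<sigma> k n) < e" by blast
    with conjunct2[OF banach[of n, unfolded banach_space_def], rule_format, of "\<lambda>m. \<sigma> m n"] \<sigma>X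
    show ?thesis by simp
  qed
  then obtain x where xX: "\<And>n. x n \<in> vecs (X n)"
    and lim: "\<And>n. (\<lambda>m. nrm (X n) (\<sigma> m n - x n)) \<longlonglongrightarrow> 0" by metis
  have close: "\<exists>M. \<forall>m\<ge>M. \<sigma> m - x \<in> vecs S \<and> nrm S (\<sigma> m - x) \<le> e" if e: "0 < e" for e
  proof -
    obtain M where M: "\<And>m k. m \<ge> M \<Longrightarrow> k \<ge> M \<Longrightarrow> nrm S (\<sigma> m - \<sigma> k) < e" using cauchy e by metis
    have "sum (pwr (\<sigma> m - x)) {..<K} \<le> e powr p" if m: "m \<ge> M" for m K
    proof -
      have "(\<lambda>k. nrm (X n) (\<sigma> m n - \<sigma> k n)) \<longlonglongrightarrow> nrm (X n) (\<sigma> m n - x n)" for n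
      proof (rule real_tendsto_sandwich)
        let ?d = "\<lambda>k. nrm (X n) (\<sigma> k n - x n)" and ?c = "nrm (X n) (\<sigma> m n - x n)"
        show "\<forall>\<^sub>F k in sequentially. ?c - ?d k \<le> nrm (X n) (\<sigma> m n - \<sigma> k n)"
          using nrm_triangle_diff[OF normed \<sigma>X \<sigma>X xX] by (simp add: diff_le_eq)
        show "\<forall>\<^sub>F k in sequentially. nrm (X n) (\<sigma> m n - \<sigma> k n) \<le> ?c + ?d k"
          using nrm_triangle_diff[OF normed \<sigma>X xX \<sigma>X] nrm_diff_commute[OF normed \<sigma>X xX] by simp
        show "(\<lambda>k. ?c - ?d k) \<longlonglongrightarrow> ?c" using tendsto_diff[OF tendsto_const lim] by fastforce
        show "(\<lambda>k. ?c + ?d k) \<longlonglongrightarrow> ?c" using tendsto_add[OF tendsto_const lim] by fastforce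
      qed
      hence "(\<lambda>k. sum (pwr (\<sigma> m - \<sigma> k)) {..<K}) \<longlonglongrightarrow> sum (pwr (\<sigma> m - x)) {..<K}"
        unfolding pwr_def minus_apply
        using nrm_nonneg[OF normed vecs_diff[OF normed \<sigma>X \<sigma>X]] p_pos
        by (intro tendsto_sum tendsto_powr2) auto
      moreover have "\<forall>k\<ge>M. sum (pwr (\<sigma> m - \<sigma> k)) {..<K} \<le> e powr p"
      proof (intro allI impI)
        fix k assume "k \<ge> M"
        hence "nrm S (\<sigma> m - \<sigma> k) powr p \<le> e powr p"
          using M[OF m] p_pos nrm_ge_0 by (intro powr_mono2) (auto intro: less_imp_le)
        thus "sum (pwr (\<sigma> m - \<sigma> k)) {..<K} \<le> e powr p"
          using sum_pwr_le[OF S_diff[OF \<sigma>S \<sigma>S], of "{..<K}" m k] by simp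
      qed
      ultimately show ?thesis by (meson LIMSEQ_le_const2)
    qed
    hence "\<sigma> m - x \<in> vecs S \<and> nrm S (\<sigma> m - x) \<le> e" if "m \<ge> M" for m
      using in_lp_sumI[of "\<sigma> m - x" e] e that xX \<sigma>X by (simp add: vecs_diff[OF normed])
    thus ?thesis by blast
  qed
  \<comment> \<open>The tolerance \<open>1\<close> is arbitrary: a single \<open>\<sigma> M\<close>
    with \<open>\<sigma> M - x\<close> in the sum puts \<open>x\<close> there as well.\<close>
  obtain M where "\<sigma> M - x \<in> vecs S" using close[of 1] by auto
  hence "x \<in> vecs S" using S_diff[OF \<sigma>S[of M], of "\<sigma> M - x"] by simp
  moreover have "(\<lambda>m. nrm S (\<sigma> m - x)) \<longlonglongrightarrow> 0"
  proof (rule LIMSEQ_I)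
    fix e :: real assume e: "0 < e"
    then obtain M where "\<forall>m\<ge>M. nrm S (\<sigma> m - x) \<le> e / 2" using close[of "e / 2"] by auto
    thus "\<exists>M. \<forall>m\<ge>M. norm (nrm S (\<sigma> m - x) - 0) < e"
      using e by (intro exI[of _ M]) (fastforce simp: nrm_ge_0)
  qed
  ultimately show "\<exists>x\<in>vecs S. (\<lambda>m. nrm S (\<sigma> m - x)) \<longlonglongrightarrow> 0" by blast
qed

subsection \<open>Blocks of coordinates\<close>

lemma pwr_block: "pwr (block A x) n = (if n \<in> A then pwr x n else 0)"
  using p by (simp add: pwr_def block_def nrm_zero[OF normed])

lemma block_in_lp_sum:
  assumes x: "x \<in> vecs S"
  shows "block A x \<in> vecs S" "nrm S (block A x) \<le> nrm S x"
proof -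
  have "sum (pwr (block A x)) {..<k} \<le> nrm S x powr p" for k
  proof -
    have "sum (pwr (block A x)) {..<k} \<le> sum (pwr x) {..<k}"
      by (intro sum_mono) (simp add: pwr_block pwr_nonneg)
    also have "\<dots> \<le> nrm S x powr p" by (simp add: sum_pwr_le x)
    finally show ?thesis .
  qed
  thus "block A x \<in> vecs S" "nrm S (block A x) \<le> nrm S x"
    using coord[OF x]
    by (auto intro!: in_lp_sumI nrm_ge_0) (auto simp: block_def vecs_zero[OF normed])
qed

text \<open>Stated for sequences not yet known to be summable: a candidate vector read off from the
  coordinates of a bidual element is treated in this way.\<close>

lemma finite_block_in_lp_sum:
  assumes "finite A" "\<And>n. x n \<in> vecs (X n)"
  shows "block A x \<in> vecs S" "nrm S (block A x) powr p = sum (pwr x) A"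
proof -
  have sums: "pwr (block A x) sums sum (pwr x) A"
    using sums_If_finite_set[OF assms(1), of "pwr x"] by (simp add: pwr_block[abs_def])
  show S: "block A x \<in> vecs S"
    using assms(2) sums by (auto simp: vecs_iff block_def vecs_zero[OF normed] sums_iff)
  show "nrm S (block A x) powr p = sum (pwr x) A"
    using sums by (simp add: nrm_powr[OF S] sums_iff)
qed

lemma single_in_lp_sum:
  assumes a: "a \<in> vecs (X n)"
  shows "single n a \<in> vecs S" "nrm S (single n a) = nrm (X n) a"
proof -
  have eq: "single n a = block {n} (single n a)" by (auto simp: single_def block_def)
  have X: "single n a m \<in> vecs (X m)" for m
    using a by (simp add: single_def vecs_zero[OF normed])
  show "single n a \<in> vecs S" by (subst eq) (rule finite_block_in_lp_sum(1)[OF _ X], simp)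
  have "nrm S (single n a) powr p = nrm (X n) a powr p"
    by (subst eq, subst finite_block_in_lp_sum(2)[OF _ X]) (simp_all add: pwr_def single_def)
  thus "nrm S (single n a) = nrm (X n) a"
    using powr_le_powr_iff[OF nrm_ge_0 nrm_nonneg[OF normed a] p_pos, of "single n a"]
      powr_le_powr_iff[OF nrm_nonneg[OF normed a] nrm_ge_0 p_pos, of "single n a"] by auto
qed

lemma block_add: "block A (x + y) = block A x + (block A y :: nat \<Rightarrow> 'a)"
  and block_scale: "block A (c *\<^sub>R x) = c *\<^sub>R (block A x :: nat \<Rightarrow> 'a)"
  by (auto simp: block_def scaleR_fun_apply fun_eq_iff)

lemma single_add: "single n (a + b) = single n a + (single n b :: nat \<Rightarrow> 'a)"
  and single_scale: "single n (c *\<^sub>R a) = c *\<^sub>R (single n a :: nat \<Rightarrow> 'a)"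
  by (auto simp: single_def scaleR_fun_apply fun_eq_iff)

text \<open>This additivity gives the convergence of tails, the factor \<open>2 powr (1 / p)\<close>
  for \<open>p > 1\<close>, and the telescoping of block norms for \<open>p = 1\<close>.\<close>

lemma nrm_block_add:
  assumes x: "x \<in> vecs S" and y: "y \<in> vecs S" and disj: "A \<inter> B = {}"
  shows "nrm S (block A x + block B y) powr p = nrm S (block A x) powr p + nrm S (block B y) powr p"
proof -
  note xy = block_in_lp_sum(1)[OF x, of A] block_in_lp_sum(1)[OF y, of B]
  have "pwr (block A x + block B y) n = pwr (block A x) n + pwr (block B y) n" for n
    using disj p by (auto simp: pwr_def block_def nrm_zero[OF normed])
  thus ?thesis
    using suminf_add[OF pwr_summable[OF xy(1)] pwr_summable[OF xy(2)]]
    by (simp add: nrm_powr xy S_add)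
qed

lemma nrm_tail_tendsto_0:
  assumes x: "x \<in> vecs S"
  shows "(\<lambda>N. nrm S (block {N..} x)) \<longlonglongrightarrow> 0"
proof -
  have eq: "nrm S (block {N..} x) = ((\<Sum>n. pwr x n) - sum (pwr x) {..<N}) powr (1/p)" for N
  proof -
    have "block {..<N} x + block {N..} x = x" by (auto simp: block_def fun_eq_iff)
    moreover have "{..<N} \<inter> {N..} = {}" by auto
    ultimately have "nrm S x powr p = nrm S (block {..<N} x) powr p + nrm S (block {N..} x) powr p"
      using nrm_block_add[OF x x, of "{..<N}" "{N..}"] by simp
    hence "nrm S (block {N..} x) powr p = (\<Sum>n. pwr x n) - sum (pwr x) {..<N}"
      using finite_block_in_lp_sum(2)[OF _ coord[OF x], of "{..<N}"] by (simp add: nrm_powr[OF x])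
    thus ?thesis using p nrm_ge_0[of "block {N..} x"] by (metis powr_powr nonzero_mult_div_cancel_left
        not_one_le_zero powr_one' abs_of_nonneg times_divide_eq_right mult.right_neutral)
  qed
  have "(\<lambda>N. (\<Sum>n. pwr x n) - sum (pwr x) {..<N}) \<longlonglongrightarrow> (\<Sum>n. pwr x n) - (\<Sum>n. pwr x n)"
    by (intro tendsto_intros summable_LIMSEQ pwr_summable x)
  moreover have "\<forall>N. 0 \<le> (\<Sum>n. pwr x n) - sum (pwr x) {..<N}"
    using sum_le_suminf[OF pwr_summable[OF x]] pwr_nonneg by simp
  ultimately show ?thesis
    unfolding eq using p by (intro tendsto_zero_powrI[where b = "1/p"]) auto
qed

lemma nrm_tail_antimono:
  assumes "x \<in> vecs S" "M \<le> N"
  shows "nrm S (block {N..} x) \<le> nrm S (block {M..} x)"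
proof -
  have "block {N..} x = block {N..} (block {M..} x)" using assms(2) by (auto simp: block_def)
  thus ?thesis using block_in_lp_sum(2)[OF block_in_lp_sum(1)[OF assms(1)]] by metis
qed

end

section \<open>Almost norming vectors and weak cluster points\<close>

lemma dual_nrm_less:
  assumes X: "normed_space X" and f: "f \<in> vecs (dual X)" and d: "d < nrm (dual X) f"
  obtains x where "x \<in> vecs X" "nrm X x \<le> 1" "d < f x"
proof -
  have "\<exists>x\<in>{x \<in> vecs X. nrm X x \<le> 1}. d < \<bar>f x\<bar>"
  proof (rule ccontr)
    assume "\<not> ?thesis"
    hence "(SUP x\<in>{x \<in> vecs X. nrm X x \<le> 1}. \<bar>f x\<bar>) \<le> d"
      using vecs_zero[OF X] nrm_zero[OF X] by (intro cSUP_least) force+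
    thus False using d by (simp add: dual_def)
  qed
  then obtain x where x: "x \<in> vecs X" "nrm X x \<le> 1" "d < \<bar>f x\<bar>" by blast
  show thesis
  proof (cases "0 \<le> f x")
    case True
    thus ?thesis using that[of x] x by simp
  next
    case False
    thus ?thesis
      using that[of "(-1) *\<^sub>R x"] x vecs_scale[OF X x(1), of "-1"] nrm_scale[OF X x(1), of "-1"]
        dual_scale[OF f x(1), of "-1"] by simp
  qed
qed

text \<open>As the compact set is the image of \<open>A\<close>, the cluster point is not just an
  element of the bidual but a vector of \<open>A\<close>; its own tails are therefore small.\<close>

lemma embedded_cluster_point:
  fixes x :: "nat \<Rightarrow> 'a::real_vector"
  assumes L: "compactin (weak_star (dual X)) (canonical_embedding X ` A)" and x: "\<And>n. x n \<in> A"
  obtains a where "a \<in> A"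
    "\<And>F e N. finite F \<Longrightarrow> F \<subseteq> vecs (dual X) \<Longrightarrow> 0 < e \<Longrightarrow> \<exists>n\<ge>N. \<forall>f\<in>F. \<bar>f (x n) - f a\<bar> < e"
proof -
  obtain z where z: "z \<in> canonical_embedding X ` A"
    "\<And>F e N. finite F \<Longrightarrow> F \<subseteq> vecs (dual X) \<Longrightarrow> 0 < e \<Longrightarrow>
      \<exists>n\<ge>N. \<forall>f\<in>F. \<bar>canonical_embedding X (x n) f - z f\<bar> < e"
    by (rule weak_star_cluster_point[OF L, of "\<lambda>n. canonical_embedding X (x n)"]) (use x in auto)
  then obtain a where a: "a \<in> A" "z = canonical_embedding X a" by blast
  show thesis
  proof (rule that[OF a(1)])
    fix F :: "('a \<Rightarrow> real) set" and e :: real and N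
    assume F: "finite F" "F \<subseteq> vecs (dual X)" and e: "0 < e"
    then obtain n where "n \<ge> N" "\<forall>f\<in>F. \<bar>canonical_embedding X (x n) f - z f\<bar> < e"
      using z(2) by blast
    thus "\<exists>n\<ge>N. \<forall>f\<in>F. \<bar>f (x n) - f a\<bar> < e"
      using F(2) a(2) canonical_embedding_apply[of _ X] by (metis (no_types, lifting) subsetD)
  qed
qed

lemma sum_fun_apply: "(\<Sum>i\<in>I. f i) x = (\<Sum>i\<in>I. f i x :: 'b::comm_monoid_add)"
  by (induction I rule: infinite_finite_induct) auto

context lp_sequence
begin

subsection \<open>Functionals on the \<open>\<ell>\<^sub>p\<close>-sum\<close>

text \<open>The adjoint of \<open>block A\<close>; \<open>block_dual {N..} f\<close> is
  \<open>f \<circ> T\<^sub>N\<close>. The case distinction keeps the convention of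
  \<open>dual\<close>, because \<open>block A x\<close> can lie in the sum when \<open>x\<close>
  does not.\<close>

definition block_dual :: "nat set \<Rightarrow> ((nat \<Rightarrow> 'a) \<Rightarrow> real) \<Rightarrow> (nat \<Rightarrow> 'a) \<Rightarrow> real" where
  "block_dual A f = (\<lambda>x. if x \<in> vecs S then f (block A x) else 0)"

definition lift :: "nat \<Rightarrow> ('a \<Rightarrow> real) \<Rightarrow> (nat \<Rightarrow> 'a) \<Rightarrow> real" where
  "lift n \<phi> = (\<lambda>x. if x \<in> vecs S then \<phi> (x n) else 0)"

text \<open>The adjoint of the inclusion \<open>single n\<close> of the \<open>n\<close>-th
  summand.\<close>

definition restr :: "nat \<Rightarrow> ((nat \<Rightarrow> 'a) \<Rightarrow> real) \<Rightarrow> 'a \<Rightarrow> real" where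
  "restr n f = (\<lambda>a. if a \<in> vecs (X n) then f (single n a) else 0)"

text \<open>The second adjoint of the \<open>n\<close>-th coordinate projection; \<open>lift n\<close> is the first adjoint.\<close>

definition biproj :: "nat \<Rightarrow> (((nat \<Rightarrow> 'a) \<Rightarrow> real) \<Rightarrow> real) \<Rightarrow> ('a \<Rightarrow> real) \<Rightarrow> real" where
  "biproj n z = (\<lambda>\<phi>. if \<phi> \<in> vecs (dual (X n)) then z (lift n \<phi>) else 0)"

lemmas S_normed = normed_space_lp_sum
  and S_dual = normed_space_dual[OF normed_space_lp_sum]

lemma block_dual_le:
  assumes "f \<in> vecs (dual S)" "x \<in> vecs S"
  shows "\<bar>block_dual A f x\<bar> \<le> nrm (dual S) f * nrm S (block A x)"
  using dual_le[OF S_normed assms(1) block_in_lp_sum(1)[OF assms(2)]] assms(2)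
  by (simp add: block_dual_def)

lemma block_dual_le_nrm:
  assumes f: "f \<in> vecs (dual S)" and x: "x \<in> vecs S"
  shows "\<bar>block_dual A f x\<bar> \<le> nrm (dual S) f * nrm S x"
  using block_dual_le[OF f x, of A]
    mult_left_mono[OF block_in_lp_sum(2)[OF x, of A] nrm_dual_nonneg[OF S_normed f]] by linarith

lemma block_dual_in_dual:
  assumes f: "f \<in> vecs (dual S)"
  shows "block_dual A f \<in> vecs (dual S)" "nrm (dual S) (block_dual A f) \<le> nrm (dual S) f"
proof -
  show "block_dual A f \<in> vecs (dual S)"
  proof (rule dualI[OF _ _ _ block_dual_le_nrm[OF f]])
    fix x y assume "x \<in> vecs S" "y \<in> vecs S"
    thus "block_dual A f (x + y) = block_dual A f x + block_dual A f y"
      by (simp add: block_dual_def block_add S_add dual_add[OF f] block_in_lp_sum(1))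
  next
    fix c x assume "x \<in> vecs S"
    thus "block_dual A f (c *\<^sub>R x) = c * block_dual A f x"
      by (simp add: block_dual_def block_scale vecs_scale[OF S_normed] dual_scale[OF f]
          block_in_lp_sum(1))
  qed (simp add: block_dual_def)
  show "nrm (dual S) (block_dual A f) \<le> nrm (dual S) f"
    by (rule nrm_dual_le[OF S_normed nrm_dual_nonneg[OF S_normed f] block_dual_le_nrm[OF f]])
qed

lemma block_dual_block_dual: "block_dual A (block_dual B f) = block_dual (B \<inter> A) f"
  by (auto simp: block_dual_def block_block block_in_lp_sum(1) fun_eq_iff)

lemma block_dual_split:
  assumes f: "f \<in> vecs (dual S)"
  shows "f = block_dual {..<N} f + block_dual {N..} f"
proof
  fix x :: "nat \<Rightarrow> 'a"
  have "block {..<N} x + block {N..} x = x" by (auto simp: block_def fun_eq_iff)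
  thus "f x = (block_dual {..<N} f + block_dual {N..} f) x"
    using dual_add[OF f block_in_lp_sum(1) block_in_lp_sum(1), of x x "{..<N}" "{N..}"]
      dual_outside[OF f, of x]
    by (auto simp: block_dual_def)
qed

lemma dual_tail_tendsto_0:
  assumes f: "f \<in> vecs (dual S)" and x: "x \<in> vecs S"
  shows "(\<lambda>N. f (block {N..} x)) \<longlonglongrightarrow> 0"
proof (rule Lim_null_comparison)
  show "\<forall>\<^sub>F N in sequentially. norm (f (block {N..} x)) \<le> nrm (dual S) f * nrm S (block {N..} x)"
    using dual_le[OF S_normed f block_in_lp_sum(1)[OF x]] by simp
  show "(\<lambda>N. nrm (dual S) f * nrm S (block {N..} x)) \<longlonglongrightarrow> 0"
    using tendsto_mult_right_zero[OF nrm_tail_tendsto_0[OF x]] by simp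
qed

lemma lift_in_dual:
  assumes \<phi>: "\<phi> \<in> vecs (dual (X n))"
  shows "lift n \<phi> \<in> vecs (dual S)" "nrm (dual S) (lift n \<phi>) \<le> nrm (dual (X n)) \<phi>"
proof -
  have le: "\<bar>lift n \<phi> x\<bar> \<le> nrm (dual (X n)) \<phi> * nrm S x" if x: "x \<in> vecs S" for x
    using dual_le[OF normed \<phi> coord[OF x]] x
      mult_left_mono[OF nrm_coord_le[OF x, of n] nrm_dual_nonneg[OF normed \<phi>]]
    by (simp add: lift_def)
  show "lift n \<phi> \<in> vecs (dual S)"
    by (rule dualI[OF _ _ _ le])
      (auto simp: lift_def S_add vecs_scale[OF S_normed] scaleR_fun_apply coord
        dual_add[OF \<phi>] dual_scale[OF \<phi>])
  show "nrm (dual S) (lift n \<phi>) \<le> nrm (dual (X n)) \<phi>"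
    by (rule nrm_dual_le[OF S_normed nrm_dual_nonneg[OF normed \<phi>] le])
qed

lemma restr_in_dual:
  assumes f: "f \<in> vecs (dual S)"
  shows "restr n f \<in> vecs (dual (X n))"
proof (rule dualI[where C = "nrm (dual S) f"])
  fix a assume a: "a \<in> vecs (X n)"
  show "\<bar>restr n f a\<bar> \<le> nrm (dual S) f * nrm (X n) a"
    using dual_le[OF S_normed f single_in_lp_sum(1)[OF a]] a
    by (simp add: restr_def single_in_lp_sum(2))
qed (auto simp: restr_def vecs_add[OF normed] vecs_scale[OF normed] single_add single_scale
    dual_add[OF f] dual_scale[OF f] single_in_lp_sum(1))

lemma dual_head:
  assumes f: "f \<in> vecs (dual S)" and x: "\<And>n. x n \<in> vecs (X n)"
  shows "f (block {..<N} x) = (\<Sum>n<N. restr n f (x n))"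
proof -
  have "f (block {..<N} x) = (\<Sum>n<N. f (single n (x n)))"
    unfolding sum_single_eq_block[symmetric]
    using single_in_lp_sum(1)[OF x] by (intro dual_sum[OF S_normed f]) auto
  thus ?thesis using x by (simp add: restr_def)
qed

text \<open>Consequently the values of a bidual element on heads of functionals are determined by
  its coordinates \<open>biproj n z\<close>.\<close>

lemma block_dual_head:
  assumes f: "f \<in> vecs (dual S)"
  shows "block_dual {..<N} f = (\<Sum>n<N. lift n (restr n f))"
  using dual_head[OF f coord] by (auto simp: fun_eq_iff sum_fun_apply block_dual_def lift_def)

lemma biproj_in_bidual:
  assumes z: "z \<in> vecs (dual (dual S))"
  shows "biproj n z \<in> vecs (dual (dual (X n)))"
proof (rule dualI[where C = "nrm (dual (dual S)) z"])
  have add: "lift n (\<phi> + \<psi>) = lift n \<phi> + lift n \<psi>" for \<phi> \<psi> by (auto simp: lift_def)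
  have scale: "lift n (c *\<^sub>R \<phi>) = c *\<^sub>R lift n \<phi>" for c \<phi>
    by (auto simp: lift_def scaleR_fun_apply)
  note D = normed_space_dual[OF normed, of n]
  fix \<phi> assume \<phi>: "\<phi> \<in> vecs (dual (X n))"
  show "\<bar>biproj n z \<phi>\<bar> \<le> nrm (dual (dual S)) z * nrm (dual (X n)) \<phi>"
    using dual_le[OF S_dual z lift_in_dual(1)[OF \<phi>]] \<phi>
      mult_left_mono[OF lift_in_dual(2)[OF \<phi>] nrm_dual_nonneg[OF S_dual z]]
    by (simp add: biproj_def)
  show "biproj n z (c *\<^sub>R \<phi>) = c * biproj n z \<phi>" for c
    using \<phi> by (simp add: biproj_def vecs_scale[OF D] scale dual_scale[OF z] lift_in_dual(1))
  fix \<psi> assume \<psi>: "\<psi> \<in> vecs (dual (X n))"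
  show "biproj n z (\<phi> + \<psi>) = biproj n z \<phi> + biproj n z \<psi>"
    using \<phi> \<psi> by (simp add: biproj_def vecs_add[OF D] add dual_add[OF z] lift_in_dual(1))
qed (simp add: biproj_def)

text \<open>Evaluating \<open>biproj n z\<close> at \<open>\<phi>\<close> amounts to evaluating
  \<open>z\<close> at \<open>lift n \<phi>\<close>, which is weak* continuous in
  \<open>z\<close>.\<close>

lemma continuous_map_biproj:
  "continuous_map (weak_star (dual S)) (weak_star (dual (X n))) (biproj n)"
proof (rule continuous_map_into_weak_star)
  fix \<phi> assume "\<phi> \<in> vecs (dual (X n))"
  thus "continuous_map (weak_star (dual S)) euclideanreal (\<lambda>z. biproj n z \<phi>)"
    by (simp add: biproj_def continuous_map_weak_star_eval lift_in_dual(1))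
qed (simp add: topspace_weak_star biproj_in_bidual)

lemma biproj_canonical_embedding:
  assumes x: "x \<in> vecs S"
  shows "biproj n (canonical_embedding S x) = canonical_embedding (X n) (x n)"
  using x lift_in_dual(1)[of _ n] by (auto simp: biproj_def canonical_embedding_def fun_eq_iff lift_def)

text \<open>A functional whose norm on tails does not tend to \<open>0\<close> would take, on the sum of two disjoint
  almost norming vectors, a value close to twice its norm; but this sum has norm at most
  \<open>2 powr (1 / p) < 2\<close>.\<close>

lemma dual_tail_nrm_tendsto_0:
  assumes p1: "1 < p" and f: "f \<in> vecs (dual S)"
  shows "(\<lambda>N. nrm (dual S) (block_dual {N..} f)) \<longlonglongrightarrow> 0"
proof -
  define t where "t N = nrm (dual S) (block_dual {N..} f)" for N
  note T = block_dual_in_dual(1)[OF f]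
  have nonneg: "0 \<le> t N" for N unfolding t_def by (rule nrm_dual_nonneg[OF S_normed T])
  have "decseq t"
  proof (rule decseq_SucI)
    fix N
    have "block_dual {Suc N..} (block_dual {N..} f) = block_dual {Suc N..} f"
      by (simp add: block_dual_block_dual Int_absorb1)
    thus "t (Suc N) \<le> t N" using block_dual_in_dual(2)[OF T, of "{Suc N..}"] by (metis t_def)
  qed
  then obtain c where lim: "t \<longlonglongrightarrow> c" and c: "\<And>N. c \<le> t N"
    using decseq_convergent[of t 0] nonneg by metis
  have "c = 0"
  proof (rule ccontr)
    assume "c \<noteq> 0"
    moreover have "0 \<le> c" using LIMSEQ_le_const[OF lim] nonneg by blast
    ultimately have c_pos: "0 < c" by simp
    define r where "r = (2::real) powr (1 / p)"
    have "r < 2 powr 1" unfolding r_def using p1 by (intro powr_less_mono) auto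
    hence r: "0 < r" "r < 2" by (auto simp: r_def)
    \<comment> \<open>Chosen so that \<open>2 * (c - d) = r * (c + d)\<close>: the lower bound from
      two almost norming vectors then contradicts the upper bound from the norm of their
      sum.\<close>
    define d where "d = (2 - r) * c / (2 + r)"
    have d: "0 < d" "(2 + r) * d = (2 - r) * c" using r c_pos by (auto simp: d_def)
    have "\<forall>\<^sub>F N in sequentially. t N < c + d" using order_tendstoD(2)[OF lim] d by simp
    then obtain N where N: "t N < c + d" by (auto simp: eventually_sequentially)
    let ?g = "block_dual {N..} f"
    have "c - d < t N" using c[of N] d by linarith
    then obtain x where x: "x \<in> vecs S" "nrm S x \<le> 1" "c - d < ?g x"
      using dual_nrm_less[OF S_normed T] unfolding t_def by metis
    have head: "?g (block {..<M} x) = ?g x - ?g (block {M..} x)" for M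
    proof -
      have "?g x = ?g (block {..<M} x + block {M..} x)"
        by (rule arg_cong[of _ _ ?g]) (auto simp: block_def fun_eq_iff)
      thus ?thesis by (simp add: dual_add[OF T] block_in_lp_sum(1)[OF x(1)])
    qed
    \<comment> \<open>Cutting \<open>x\<close> off at a large \<open>M \<ge> N\<close> keeps the
      value above \<open>c - d\<close> and makes room for a second vector supported from
      \<open>M\<close> on.\<close>
    have "(\<lambda>M. ?g (block {..<M} x)) \<longlonglongrightarrow> ?g x - 0"
      unfolding head by (intro tendsto_intros dual_tail_tendsto_0[OF T x(1)])
    from order_tendstoD(1)[OF this, of "c - d"] x(3)
    have "\<forall>\<^sub>F M in sequentially. c - d < ?g (block {..<M} x)" by simp
    hence "\<forall>\<^sub>F M in sequentially. c - d < ?g (block {..<M} x) \<and> N \<le> M"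
      by (rule eventually_conj) (rule eventually_ge_at_top)
    then obtain M where M: "c - d < ?g (block {..<M} x)" "N \<le> M"
      by (auto simp: eventually_sequentially)
    have "c - d < t M" using c[of M] d by linarith
    then obtain y where y: "y \<in> vecs S" "nrm S y \<le> 1" "c - d < block_dual {M..} f y"
      using dual_nrm_less[OF S_normed T] unfolding t_def by metis
    note bx = block_in_lp_sum[OF x(1), of "{..<M}"] and yb = block_in_lp_sum[OF y(1), of "{M..}"]
    let ?w = "block {..<M} x + block {M..} y"
    have w: "?w \<in> vecs S" using bx yb by (simp add: S_add)
    have "?g (block {M..} y) = block_dual {M..} f y"
      using M(2) yb(1) y(1) by (simp add: block_dual_def block_block Int_absorb1)
    hence "2 * (c - d) < ?g ?w"
      using M(1) y(3) dual_add[OF T bx(1) yb(1)] by simp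
    moreover have "?g ?w \<le> t N * nrm S ?w" using dual_le[OF S_normed T w, of "{N..}"] by (simp add: t_def)
    moreover have "nrm S ?w \<le> r"
    proof -
      have "{..<M} \<inter> {M..} = {}" by auto
      hence "nrm S ?w powr p = nrm S (block {..<M} x) powr p + nrm S (block {M..} y) powr p"
        by (rule nrm_block_add[OF x(1) y(1)])
      also have "\<dots> \<le> 1 powr p + 1 powr p"
        using bx yb x y p by (intro add_mono powr_mono2 nrm_ge_0) auto
      also have "\<dots> = r powr p" using p by (simp add: r_def powr_powr)
      finally show ?thesis using powr_le_powr_iff[OF nrm_ge_0 less_imp_le[OF r(1)] p_pos] by simp
    qed
    hence "t N * nrm S ?w \<le> (c + d) * r"
      using N nonneg c_pos d by (intro mult_mono nrm_ge_0) auto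
    ultimately have "2 * (c - d) < (c + d) * r" by linarith
    thus False using d(2) by (simp add: algebra_simps)
  qed
  thus ?thesis using lim by (simp add: t_def[abs_def])
qed

subsection \<open>Recognising the \<open>\<ell>\<^sub>p\<close>-sum in its bidual\<close>

text \<open>On heads \<open>z\<close> acts as its coordinate sequence \<open>x\<close>. This bounds
  the heads of \<open>x\<close> by the norm of \<open>z\<close>, so \<open>x\<close> lies in the
  sum; the remaining difference, \<open>z\<close> on the tail of \<open>f\<close> minus
  \<open>f\<close> on the tail of \<open>x\<close>, tends to \<open>0\<close>.\<close>

lemma bidual_in_embedding:
  assumes z: "z \<in> vecs (dual (dual S))"
    and coords: "\<And>n. biproj n z \<in> canonical_embedding (X n) ` vecs (X n)"
    and tails: "\<And>f. f \<in> vecs (dual S) \<Longrightarrow> (\<lambda>N. z (block_dual {N..} f)) \<longlonglongrightarrow> 0"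
  shows "z \<in> canonical_embedding S ` vecs S"
proof -
  obtain x where x: "\<And>n. x n \<in> vecs (X n)" and zx: "\<And>n. biproj n z = canonical_embedding (X n) (x n)"
    using coords unfolding image_iff by metis
  have z_head: "z (block_dual {..<N} f) = f (block {..<N} x)" if f: "f \<in> vecs (dual S)" for f N
  proof -
    have "z (block_dual {..<N} f) = (\<Sum>n<N. z (lift n (restr n f)))"
      unfolding block_dual_head[OF f]
      by (intro dual_sum[OF S_dual z]) (auto intro: lift_in_dual(1) restr_in_dual f)
    also have "\<dots> = (\<Sum>n<N. biproj n z (restr n f))"
      by (simp add: biproj_def restr_in_dual f)
    also have "\<dots> = (\<Sum>n<N. restr n f (x n))"
      by (simp add: zx canonical_embedding_apply restr_in_dual f)
    finally show ?thesis by (simp add: dual_head[OF f x])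
  qed
  have xS: "x \<in> vecs S"
  proof (rule in_lp_sumI(1)[OF x])
    show "0 \<le> nrm (dual (dual S)) z" by (rule nrm_dual_nonneg[OF S_dual z])
    fix k
    note hd = finite_block_in_lp_sum[OF finite_lessThan x, of k]
    have "nrm S (block {..<k} x) \<le> nrm (dual (dual S)) z"
    proof (rule nrm_le_if_dual_ball_le[OF S_normed hd(1)])
      fix f assume f: "f \<in> vecs (dual S)" "nrm (dual S) f \<le> 1"
      have "f (block {..<k} x) \<le> nrm (dual (dual S)) z * nrm (dual S) (block_dual {..<k} f)"
        using dual_le[OF S_dual z block_dual_in_dual(1)[OF f(1)], of "{..<k}"]
        by (simp add: z_head[OF f(1)])
      also have "\<dots> \<le> nrm (dual (dual S)) z * 1"
        using block_dual_in_dual(2)[OF f(1), of "{..<k}"] f(2)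
        by (intro mult_left_mono nrm_dual_nonneg[OF S_dual z]) linarith
      finally show "f (block {..<k} x) \<le> nrm (dual (dual S)) z" by simp
    qed
    thus "sum (pwr x) {..<k} \<le> nrm (dual (dual S)) z powr p"
      unfolding hd(2)[symmetric] using p_pos by (intro powr_mono2 nrm_ge_0) auto
  qed
  have "z f = f x" if f: "f \<in> vecs (dual S)" for f
  proof -
    have "z f = f (block {..<N} x) + z (block_dual {N..} f)" for N
      using dual_add[OF z block_dual_in_dual(1)[OF f] block_dual_in_dual(1)[OF f], of "{..<N}" "{N..}"]
      by (simp add: block_dual_split[OF f, symmetric] z_head[OF f])
    moreover have "f x = f (block {..<N} x) + f (block {N..} x)" for N
      using fun_cong[OF block_dual_split[OF f, of N], of x] xS by (simp add: block_dual_def)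
    \<comment> \<open>The left side does not depend on \<open>N\<close>, so the limit of the right
      side is its value.\<close>
    ultimately have eq: "z f - f x = z (block_dual {N..} f) - f (block {N..} x)" for N
      by (smt (verit))
    have "(\<lambda>N. z (block_dual {N..} f) - f (block {N..} x)) \<longlonglongrightarrow> 0 - 0"
      by (intro tendsto_diff tails f dual_tail_tendsto_0 xS)
    hence "(\<lambda>N::nat. z f - f x) \<longlonglongrightarrow> 0" by (simp add: eq[symmetric])
    thus ?thesis by (simp add: LIMSEQ_const_iff)
  qed
  hence "z = canonical_embedding S x"
    using dual_outside[OF z] by (auto simp: canonical_embedding_def)
  thus ?thesis using xS by blast
qed

end

context lp_sequence
begin

subsection \<open>Weakly compact subsets of \<open>\<ell>\<^sub>1\<close>-sums\<close>

text \<open>For \<open>p = 1\<close> the norm itself is additive over disjoint blocks; written as a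
  difference of tails, the estimates over consecutive blocks telescope.\<close>

lemma l1_middle_block:
  assumes p1: "p = 1" and x: "x \<in> vecs S" and "n \<le> m"
  shows "nrm S (block {n..<m} x) = nrm S (block {n..} x) - nrm S (block {m..} x)"
proof -
  have "block {n..} x = block {n..<m} x + block {m..} x"
    using \<open>n \<le> m\<close> by (auto simp: block_def fun_eq_iff)
  moreover have "{n..<m} \<inter> {m..} = {}" by auto
  moreover have "nrm S y powr p = nrm S y" for y using nrm_ge_0[of y] by (simp add: p1)
  ultimately show ?thesis using nrm_block_add[OF x x, of "{n..<m}" "{m..}"] by simp
qed

text \<open>Gliding hump. If the tails are not uniformly small, there are \<open>x\<close>'s in \<open>A\<close> and functionals
  \<open>f\<^sub>l\<close> supported on disjoint blocks such that \<open>f\<^sub>l\<close> is large at the \<open>l\<close>-th vector. Each vector is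
  chosen close, on all previous functionals, to one fixed cluster point \<open>a\<close>. As \<open>p = 1\<close>, the sum \<open>g\<close>
  of all \<open>f\<^sub>l\<close> is a functional; it is large along the sequence but small at every cluster point,
  since a cluster point agrees with \<open>a\<close> on all \<open>f\<^sub>l\<close>.\<close>

lemma l1_uniform_tails:
  assumes p1: "p = 1" and A: "A \<subseteq> vecs S"
    and cpt: "compactin (weak_star (dual S)) (canonical_embedding S ` A)" and e: "0 < e"
  shows "\<exists>N. \<forall>x\<in>A. nrm S (block {N..} x) \<le> e"
proof (rule ccontr)
  assume "\<not> ?thesis"
  hence "\<forall>N. \<exists>x\<in>A. e < nrm S (block {N..} x)" by (meson not_le)
  then obtain x where xA: "\<And>N. x N \<in> A" and x_big: "\<And>N. e < nrm S (block {N..} (x N))" by metis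
  define \<tau> where "\<tau> N y = nrm S (block {N..} y)" for N y
  have xS: "x N \<in> vecs S" for N using xA A by blast
  have \<tau>_antimono: "\<tau> N y \<le> \<tau> M y" if "y \<in> vecs S" "M \<le> N" for M N y
    unfolding \<tau>_def using that by (rule nrm_tail_antimono)
  have \<tau>_nonneg: "0 \<le> \<tau> N y" for N y by (simp add: \<tau>_def nrm_ge_0)
  have \<tau>_small: "\<exists>N\<ge>M. \<tau> N y < d" if "y \<in> vecs S" "0 < d" for y d M
  proof -
    have "\<forall>\<^sub>F N in sequentially. \<tau> N y < d \<and> M \<le> N"
      unfolding \<tau>_def using that
      by (intro eventually_conj order_tendstoD(2)[OF nrm_tail_tendsto_0] eventually_ge_at_top)
    thus ?thesis by (auto simp: eventually_sequentially)
  qed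
  obtain a where aA: "a \<in> A" and a: "\<And>F d N. finite F \<Longrightarrow> F \<subseteq> vecs (dual S) \<Longrightarrow> 0 < d \<Longrightarrow>
      \<exists>n\<ge>N. \<forall>f\<in>F. \<bar>f (x n) - f a\<bar> < d"
    by (rule embedded_cluster_point[OF cpt, of x]) (use xA in auto)
  have aS: "a \<in> vecs S" using aA A by blast
  \<comment> \<open>With \<open>e = 6 * \<eta>\<close>, the hump contributes at least
    \<open>5 * \<eta>\<close> to \<open>g\<close>, earlier functionals take away at most
    \<open>2 * \<eta>\<close> and later ones at most \<open>\<eta>\<close>, which leaves
    \<open>2 * \<eta>\<close>. At the cluster point \<open>g\<close> is below \<open>\<eta>\<close>,
    and approximating it within \<open>\<eta>\<close> is contradictory.\<close>
  define \<eta> where "\<eta> = e / 6"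
  have \<eta>: "0 < \<eta>" using e by (simp add: \<eta>_def)
  obtain N0 where N0: "\<tau> N0 a < \<eta>" using \<tau>_small[OF aS \<eta>] by blast
  \<comment> \<open>In \<open>(n, m, f)\<close>, \<open>f\<close> sees only the block
    \<open>{n..<m}\<close>, which lies beyond all earlier blocks, and is large at
    \<open>x n\<close>. The tolerance \<open>\<eta> / real (Suc l)\<close> adds up to at most
    \<open>\<eta>\<close> over the \<open>l\<close> earlier functionals, and it tends to
    \<open>0\<close>, so each fixed functional converges to its value at \<open>a\<close>.\<close>
  define P where "P s l r \<longleftrightarrow> (case r of (n, m, f) \<Rightarrow>
      f \<in> vecs (dual S) \<and> N0 \<le> n \<and> n \<le> m \<and> (\<forall>i<l. fst (snd (s i)) \<le> n) \<and>
      (\<forall>y\<in>vecs S. \<bar>f y\<bar> \<le> \<tau> n y - \<tau> m y) \<and> e - \<eta> \<le> f (x n) \<and> \<tau> m (x n) < \<eta> \<and>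
      (\<forall>i<l. \<bar>snd (snd (s i)) (x n) - snd (snd (s i)) a\<bar> < \<eta> / real (Suc l)))"
    for s :: "nat \<Rightarrow> nat \<times> nat \<times> ((nat \<Rightarrow> 'a) \<Rightarrow> real)" and l r
  have "\<exists>s. \<forall>l. P s l (s l)"
  proof (rule dependent_wellorder_choice)
    fix r l and s t :: "nat \<Rightarrow> nat \<times> nat \<times> ((nat \<Rightarrow> 'a) \<Rightarrow> real)"
    assume "\<And>i. i < l \<Longrightarrow> s i = t i"
    thus "P s l r = P t l r" by (auto simp: P_def)
  next
    fix l :: nat and s
    assume prev: "\<And>i. i < l \<Longrightarrow> P s i (s i)"
    define F where "F = (\<lambda>i. snd (snd (s i))) ` {..<l}"
    \<comment> \<open>The sum serves as an upper bound for all earlier block ends.\<close>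
    define N where "N = N0 + (\<Sum>i<l. fst (snd (s i)))"
    have "F \<subseteq> vecs (dual S)" using prev by (fastforce simp: F_def P_def)
    moreover have "finite F" by (simp add: F_def)
    moreover have "0 < \<eta> / real (Suc l)" using \<eta> by simp
    ultimately obtain n where n: "n \<ge> N" "\<forall>f\<in>F. \<bar>f (x n) - f a\<bar> < \<eta> / real (Suc l)"
      using a by blast
    have "fst (snd (s i)) \<le> N" if "i < l" for i
      using member_le_sum[of i "{..<l}" "\<lambda>i. fst (snd (s i))"] that by (simp add: N_def)
    hence N: "N0 \<le> n" "\<forall>i<l. fst (snd (s i)) \<le> n" using n(1) by (auto simp: N_def intro: order_trans)
    obtain m where m: "n \<le> m" "\<tau> m (x n) < \<eta>" using \<tau>_small[OF xS \<eta>] by blast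
    obtain \<phi> where \<phi>: "\<phi> \<in> vecs (dual S)" "\<And>y. y \<in> vecs S \<Longrightarrow> \<bar>\<phi> y\<bar> \<le> nrm S y"
      "\<phi> (block {n..<m} (x n)) = nrm S (block {n..<m} (x n))"
      using norming_functional[OF S_normed block_in_lp_sum(1)[OF xS[of n], of "{n..<m}"]] by blast
    define f where "f = block_dual {n..<m} \<phi>"
    have "f \<in> vecs (dual S)" unfolding f_def by (rule block_dual_in_dual(1)[OF \<phi>(1)])
    moreover have "\<bar>f y\<bar> \<le> \<tau> n y - \<tau> m y" if "y \<in> vecs S" for y
      using \<phi>(2)[OF block_in_lp_sum(1)[OF that], of "{n..<m}"] l1_middle_block[OF p1 that m(1)] that
      by (simp add: f_def block_dual_def \<tau>_def)
    moreover have "f (x n) = \<tau> n (x n) - \<tau> m (x n)"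
      using \<phi>(3) l1_middle_block[OF p1 xS m(1)] xS by (simp add: f_def block_dual_def \<tau>_def)
    hence "e - \<eta> \<le> f (x n)" using x_big[of n] m(2) by (simp add: \<tau>_def)
    ultimately have "P s l (n, m, f)" using N m n(2) by (auto simp: P_def F_def)
    thus "\<exists>r. P s l r" by blast
  qed
  then obtain s where s: "\<And>l. P s l (s l)" by blast
  define n m f where nmf: "n l = fst (s l)" "m l = fst (snd (s l))" "f l = snd (snd (s l))" for l
  have sl: "s l = (n l, m l, f l)" for l by (simp add: nmf)
  have f: "f l \<in> vecs (dual S)" and n_ge: "N0 \<le> n l" and nm: "n l \<le> m l"
    and f_le: "\<And>y. y \<in> vecs S \<Longrightarrow> \<bar>f l y\<bar> \<le> \<tau> (n l) y - \<tau> (m l) y"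
    and f_big: "e - \<eta> \<le> f l (x (n l))" and m_small: "\<tau> (m l) (x (n l)) < \<eta>" for l
    using s[of l] by (auto simp: P_def sl)
  have mn: "m i \<le> n l" and f_close: "\<bar>f i (x (n l)) - f i a\<bar> < \<eta> / real (Suc l)" if "i < l" for i l
    using s[of l] that by (auto simp: P_def sl)
  \<comment> \<open>The blocks lie one behind the other, so the bounds
    \<open>\<tau> (n i) y - \<tau> (m i) y\<close> telescope. This makes the whole series a
    functional although its terms are not small.\<close>
  have sum_le: "(\<Sum>i\<in>{j..<k}. \<bar>f i y\<bar>) \<le> \<tau> (n j) y - \<tau> (n k) y" if y: "y \<in> vecs S" and "j \<le> k" for j k y
    using \<open>j \<le> k\<close>
  proof (induction k rule: dec_induct)
    case (step k)
    have "\<tau> (n (Suc k)) y \<le> \<tau> (m k) y" using y mn[of k "Suc k"] by (intro \<tau>_antimono) auto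
    thus ?case using step f_le[OF y, of k] by simp
  qed simp
  have partial_le: "(\<Sum>i<k. \<bar>f (i + j) y\<bar>) \<le> \<tau> (n j) y" if y: "y \<in> vecs S" for j k y
  proof -
    have "(\<Sum>i<k. \<bar>f (i + j) y\<bar>) = (\<Sum>i\<in>{j..<k + j}. \<bar>f i y\<bar>)"
      using sum.shift_bounds_nat_ivl[of "\<lambda>i. \<bar>f i y\<bar>" 0 j k] by (simp add: atLeast0LessThan)
    also have "\<dots> \<le> \<tau> (n j) y" using sum_le[OF y, of j "k + j"] \<tau>_nonneg[of "n (k + j)" y] by simp
    finally show ?thesis .
  qed
  define g where "g y = (\<Sum>i. f i y)" for y
  have total: "(\<Sum>i<k. \<bar>f i y\<bar>) \<le> 1 * nrm S y" if y: "y \<in> vecs S" for k y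
    using partial_le[OF y, of 0 k] block_in_lp_sum(2)[OF y, of "{n 0..}"] by (simp add: \<tau>_def)
  have g: "g \<in> vecs (dual S)"
    unfolding g_def[abs_def] by (rule suminf_in_dual(1)[OF S_normed f total])
  have abs_sm: "summable (\<lambda>i. \<bar>f (i + j) y\<bar>)" if "y \<in> vecs S" for j y
    using suminf_in_dual(2)[OF S_normed f total that] by (subst summable_iff_shift)
  have sm: "summable (\<lambda>i. f (i + j) y)" if "y \<in> vecs S" for j y
    by (rule summable_rabs_cancel[OF abs_sm[OF that]])
  have tail_le: "\<bar>\<Sum>i. f (i + j) y\<bar> \<le> \<tau> (n j) y" if y: "y \<in> vecs S" for j y
    using summable_rabs[OF abs_sm[OF y, of j]] suminf_le_const[OF abs_sm[OF y, of j] partial_le[OF y]]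
    by linarith
  have g_big: "2 * \<eta> \<le> g (x (n l))" for l
  proof -
    let ?y = "x (n l)"
    have split: "g ?y = (\<Sum>i. f (i + Suc l) ?y) + ((\<Sum>i<l. f i ?y) + f l ?y)"
      using suminf_split_initial_segment[OF sm[OF xS, of 0], of "n l" "Suc l"] by (simp add: g_def)
    have "\<tau> (n (Suc l)) ?y \<le> \<tau> (m l) ?y" using mn[of l "Suc l"] xS by (intro \<tau>_antimono) auto
    hence tail: "\<bar>\<Sum>i. f (i + Suc l) ?y\<bar> < \<eta>" using tail_le[OF xS, of "Suc l" "n l"] m_small[of l] by linarith
    \<comment> \<open>Earlier functionals are compared with their values at \<open>a\<close>, which
      sum to at most \<open>\<eta>\<close> because all blocks start beyond \<open>N0\<close>; the
      second \<open>\<eta>\<close> is the accumulated tolerance.\<close>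
    have "\<bar>\<Sum>i<l. f i ?y\<bar> \<le> (\<Sum>i<l. \<bar>f i a\<bar> + \<eta> / real (Suc l))"
      using f_close[of _ l] by (intro order_trans[OF sum_abs] sum_mono) (smt (verit) lessThan_iff)
    also have "\<dots> = (\<Sum>i<l. \<bar>f i a\<bar>) + real l * (\<eta> / real (Suc l))" by (simp add: sum.distrib)
    also have "\<dots> \<le> \<eta> + \<eta>"
    proof (rule add_mono)
      show "(\<Sum>i<l. \<bar>f i a\<bar>) \<le> \<eta>"
        using partial_le[OF aS, of 0 l] \<tau>_antimono[OF aS n_ge[of 0]] N0 by simp
      show "real l * (\<eta> / real (Suc l)) \<le> \<eta>" using \<eta> by (simp add: field_simps)
    qed
    finally have "\<bar>\<Sum>i<l. f i ?y\<bar> \<le> 2 * \<eta>" by simp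
    thus ?thesis using split tail f_big[of l] by (simp add: \<eta>_def)
  qed
  \<comment> \<open>A cluster point of the selected vectors only, possibly different from
    \<open>a\<close>.\<close>
  obtain b where bA: "b \<in> A" and b: "\<And>F d N. finite F \<Longrightarrow> F \<subseteq> vecs (dual S) \<Longrightarrow> 0 < d \<Longrightarrow>
      \<exists>l\<ge>N. \<forall>f\<in>F. \<bar>f (x (n l)) - f b\<bar> < d"
    by (rule embedded_cluster_point[OF cpt, of "\<lambda>l. x (n l)"]) (use xA in auto)
  have "f i b = f i a" for i
  proof (rule ccontr)
    assume neq: "f i b \<noteq> f i a"
    define d where "d = \<bar>f i b - f i a\<bar> / 2"
    have d: "0 < d" using neq by (simp add: d_def)
    obtain M where "inverse (real (Suc M)) < d / \<eta>" using reals_Archimedean[of "d / \<eta>"] d \<eta> by auto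
    hence M: "\<eta> / real (Suc M) < d" using \<eta> by (simp add: field_simps)
    \<comment> \<open>\<open>Suc i\<close> ensures \<open>i < l\<close>, so that closeness to
      \<open>f i a\<close> was demanded at stage \<open>l\<close>; \<open>M\<close> brings the
      tolerance below half of the supposed distance.\<close>
    obtain l where l: "l \<ge> max M (Suc i)" "\<bar>f i (x (n l)) - f i b\<bar> < d"
      using b[of "{f i}" d "max M (Suc i)"] f d by auto
    have "\<eta> / real (Suc l) \<le> \<eta> / real (Suc M)" using l(1) \<eta> by (intro divide_left_mono) auto
    hence "\<bar>f i (x (n l)) - f i a\<bar> < d" using f_close[of i l] l(1) M by simp
    thus False using l(2) by (simp add: d_def abs_if split: if_splits)
  qed
  hence "g b = (\<Sum>i. f (i + 0) a)" by (simp add: g_def)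
  hence "\<bar>g b\<bar> < \<eta>" using tail_le[OF aS, of 0] \<tau>_antimono[OF aS n_ge[of 0]] N0 by linarith
  moreover obtain l where "\<bar>g (x (n l)) - g b\<bar> < \<eta>" using b[of "{g}" \<eta>] g \<eta> by auto
  ultimately show False using g_big[of l] by linarith
qed

subsection \<open>The compact covering\<close>

text \<open>For \<open>p > 1\<close> the tail condition is empty: it is automatic by
  \<open>dual_tail_nrm_tendsto_0\<close>, while weakly compact sets need not have uniformly small tails.\<close>

definition tail_set :: "nat \<Rightarrow> nat \<Rightarrow> (((nat \<Rightarrow> 'a) \<Rightarrow> real) \<Rightarrow> real) set" where
  "tail_set j N = {z \<in> vecs (dual (dual S)). p = 1 \<longrightarrow>
     (\<forall>f\<in>vecs (dual S). \<bar>z (block_dual {N..} f)\<bar> \<le> inverse (real (Suc j)) * nrm (dual S) f)}"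

text \<open>The pair \<open>(n, j)\<close> names a requirement, the triple \<open>(b, m, N)\<close>
  a way to meet it. \<open>j\<close> indexes both the covering of \<open>X n\<close> and the tail
  tolerance; nothing is lost, since all pairs are intersected.\<close>

definition cover :: "(nat \<Rightarrow> nat \<Rightarrow> nat \<Rightarrow> (('a \<Rightarrow> real) \<Rightarrow> real) set) \<Rightarrow>
    nat \<Rightarrow> nat \<Rightarrow> nat \<Rightarrow> nat \<Rightarrow> nat \<Rightarrow> (((nat \<Rightarrow> 'a) \<Rightarrow> real) \<Rightarrow> real) set" where
  "cover K n j b m N = {z \<in> vecs (dual (dual S)). nrm (dual (dual S)) z \<le> real b} \<inter>
     ({z \<in> topspace (weak_star (dual S)). biproj n z \<in> K n j m} \<inter> tail_set j N)"

text \<open>For each \<open>f\<close> the bound confines one evaluation of \<open>z\<close> to a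
  closed interval; uniformity in \<open>f\<close> is an intersection of such closed
  conditions.\<close>

lemma closedin_tail_set: "closedin (weak_star (dual S)) (tail_set j N)"
proof -
  let ?T = "weak_star (dual S)"
  show ?thesis
  proof (cases "p = 1")
    case False
    hence "tail_set j N = topspace ?T" by (simp add: tail_set_def topspace_weak_star)
    thus ?thesis by simp
  next
    case True
    let ?C = "\<lambda>f. {- (inverse (real (Suc j)) * nrm (dual S) f) .. inverse (real (Suc j)) * nrm (dual S) f}"
    have imp: "(p = 1 \<longrightarrow> Q) \<longleftrightarrow> Q" for Q using True by simp
    have "tail_set j N = (\<Inter>f\<in>vecs (dual S). {z \<in> topspace ?T. z (block_dual {N..} f) \<in> ?C f})"
      unfolding tail_set_def imp
      using vecs_zero[OF S_dual] by (auto simp: topspace_weak_star abs_le_iff minus_le_iff)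
    moreover have "closedin ?T (\<Inter>f\<in>vecs (dual S). {z \<in> topspace ?T. z (block_dual {N..} f) \<in> ?C f})"
      using vecs_zero[OF S_dual]
      by (intro closedin_INT closedin_continuous_map_preimage[where Y = euclideanreal]
          continuous_map_weak_star_eval block_dual_in_dual(1)) auto
    ultimately show ?thesis by simp
  qed
qed

lemma compactin_cover:
  assumes K: "compactin (weak_star (dual (X n))) (K n j m)"
  shows "compactin (weak_star (dual S)) (cover K n j b m N)"
  unfolding cover_def
  by (intro compact_Int_closedin closedin_Int closedin_tail_set Banach_Alaoglu[OF S_dual]
      closedin_continuous_map_preimage[OF continuous_map_biproj]
      compactin_imp_closedin[OF Hausdorff_weak_star K]) simp

text \<open>Used for single vectors in the covering identity and, with \<open>b\<close>,
  \<open>m\<close>, \<open>N\<close> common to a whole compact set, in the strong statement.\<close>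

lemma canonical_embedding_in_cover:
  assumes x: "x \<in> vecs S" and b: "nrm S x \<le> real b"
    and K: "canonical_embedding (X n) (x n) \<in> K n j m"
    and tail: "p = 1 \<Longrightarrow> nrm S (block {N..} x) \<le> inverse (real (Suc j))"
  shows "canonical_embedding S x \<in> cover K n j b m N"
proof -
  have "\<bar>canonical_embedding S x (block_dual {N..} f)\<bar> \<le> inverse (real (Suc j)) * nrm (dual S) f"
    if "p = 1" and f: "f \<in> vecs (dual S)" for f
  proof -
    have "\<bar>block_dual {N..} f x\<bar> \<le> nrm (dual S) f * nrm S (block {N..} x)"
      by (rule block_dual_le[OF f x])
    also have "\<dots> \<le> nrm (dual S) f * inverse (real (Suc j))"
      using tail[OF \<open>p = 1\<close>] nrm_dual_nonneg[OF S_normed f] by (rule mult_left_mono)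
    finally show ?thesis
      by (simp add: canonical_embedding_apply block_dual_in_dual(1)[OF f] mult.commute)
  qed
  thus ?thesis
    using nrm_canonical_embedding_le[OF S_normed x] b K x
    by (simp add: cover_def tail_set_def topspace_weak_star canonical_embedding_in_bidual[OF S_normed]
        biproj_canonical_embedding)
qed

lemma tail_set_imp_tendsto_0:
  assumes z: "z \<in> vecs (dual (dual S))" and tail: "\<And>j. \<exists>N. z \<in> tail_set j N"
    and f: "f \<in> vecs (dual S)"
  shows "(\<lambda>N. z (block_dual {N..} f)) \<longlonglongrightarrow> 0"
proof (cases "p = 1")
  case False
  show ?thesis
  proof (rule Lim_null_comparison)
    show "\<forall>\<^sub>F N in sequentially. norm (z (block_dual {N..} f))
        \<le> nrm (dual (dual S)) z * nrm (dual S) (block_dual {N..} f)"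
      using dual_le[OF S_dual z block_dual_in_dual(1)[OF f]] by simp
    show "(\<lambda>N. nrm (dual (dual S)) z * nrm (dual S) (block_dual {N..} f)) \<longlonglongrightarrow> 0"
      using False p by (intro tendsto_mult_right_zero dual_tail_nrm_tendsto_0[OF _ f]) simp
  qed
next
  case True
  show ?thesis
  proof (rule LIMSEQ_I)
    fix e :: real assume e: "0 < e"
    let ?c = "nrm (dual S) f"
    have c: "0 \<le> ?c" by (rule nrm_dual_nonneg[OF S_normed f])
    \<comment> \<open>\<open>?c + 1\<close> in place of \<open>?c\<close> keeps the denominator
      positive for \<open>f = 0\<close>.\<close>
    obtain j where "inverse (real (Suc j)) < e / (?c + 1)"
      using reals_Archimedean[of "e / (?c + 1)"] c e by auto
    hence j: "inverse (real (Suc j)) * (?c + 1) < e" using c by (simp add: pos_less_divide_eq)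
    obtain N where N: "z \<in> tail_set j N" using tail by blast
    have "\<bar>z (block_dual {M..} f)\<bar> < e" if "N \<le> M" for M
    proof -
      \<comment> \<open>The bound at \<open>N\<close> is applied to the tail of \<open>f\<close>
        from \<open>M\<close> on, so one \<open>N\<close> serves all later \<open>M\<close>.\<close>
      have "block_dual {M..} f = block_dual {N..} (block_dual {M..} f)"
        using that by (simp add: block_dual_block_dual Int_absorb2)
      hence "\<bar>z (block_dual {M..} f)\<bar> \<le> inverse (real (Suc j)) * nrm (dual S) (block_dual {M..} f)"
        using N True block_dual_in_dual(1)[OF f, of "{M..}"] unfolding tail_set_def by force
      also have "\<dots> \<le> inverse (real (Suc j)) * (?c + 1)"
        using block_dual_in_dual(2)[OF f, of "{M..}"] by (intro mult_left_mono) auto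
      finally show ?thesis using j by linarith
    qed
    thus "\<exists>N. \<forall>M\<ge>N. norm (z (block_dual {M..} f) - 0) < e" by auto
  qed
qed

lemma canonical_embedding_eq_INT_cover:
  assumes K: "\<And>n. canonical_embedding (X n) ` vecs (X n) = (\<Inter>j. \<Union>m. K n j m)"
  shows "canonical_embedding S ` vecs S = (\<Inter>n. \<Inter>j. \<Union>b. \<Union>m. \<Union>N. cover K n j b m N)"
proof (intro equalityI subsetI)
  fix z assume "z \<in> canonical_embedding S ` vecs S"
  then obtain x where x: "x \<in> vecs S" "z = canonical_embedding S x" by blast
  show "z \<in> (\<Inter>n. \<Inter>j. \<Union>b. \<Union>m. \<Union>N. cover K n j b m N)"
  proof (intro INT_I)
    fix n j :: nat
    obtain b :: nat where b: "nrm S x \<le> real b" using real_arch_simple by blast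
    have "canonical_embedding (X n) (x n) \<in> (\<Inter>j. \<Union>m. K n j m)"
      using coord[OF x(1)] K by blast
    then obtain m where m: "canonical_embedding (X n) (x n) \<in> K n j m" by blast
    have "\<forall>\<^sub>F N in sequentially. nrm S (block {N..} x) < inverse (real (Suc j))"
      by (rule order_tendstoD(2)[OF nrm_tail_tendsto_0[OF x(1)]]) simp
    then obtain N where "nrm S (block {N..} x) < inverse (real (Suc j))"
      by (auto simp: eventually_sequentially)
    hence "z \<in> cover K n j b m N"
      unfolding x(2) by (intro canonical_embedding_in_cover x(1) b m) simp
    thus "z \<in> (\<Union>b. \<Union>m. \<Union>N. cover K n j b m N)" by blast
  qed
next
  fix z assume z: "z \<in> (\<Inter>n. \<Inter>j. \<Union>b. \<Union>m. \<Union>N. cover K n j b m N)"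
  hence ex: "\<exists>b m N. z \<in> cover K n j b m N" for n j by blast
  hence zd: "z \<in> vecs (dual (dual S))" by (auto simp: cover_def)
  show "z \<in> canonical_embedding S ` vecs S"
  proof (rule bidual_in_embedding[OF zd])
    fix n
    have "biproj n z \<in> (\<Inter>j. \<Union>m. K n j m)" using ex by (fastforce simp: cover_def)
    thus "biproj n z \<in> canonical_embedding (X n) ` vecs (X n)" by (simp add: K)
  next
    fix f assume "f \<in> vecs (dual S)"
    \<comment> \<open>The tail condition is the same for every \<open>n\<close>; the index
      \<open>0\<close> is an arbitrary choice.\<close>
    moreover have "\<exists>N. z \<in> tail_set j N" for j using ex[of 0 j] by (auto simp: cover_def)
    ultimately show "(\<lambda>N. z (block_dual {N..} f)) \<longlonglongrightarrow> 0"
      using tail_set_imp_tendsto_0[OF zd] by blast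
  qed
qed

text \<open>Each parameter is chosen once for all of \<open>L\<close>: \<open>b\<close> by uniform
  boundedness, \<open>m\<close> because \<open>biproj n\<close> maps \<open>L\<close> onto a compact
  subset of the embedded \<open>X n\<close>, and \<open>N\<close> by the gliding hump if
  \<open>p = 1\<close>.\<close>

lemma compactin_subset_cover:
  assumes L: "compactin (weak_star (dual S)) L" "L \<subseteq> canonical_embedding S ` vecs S"
    and K: "\<And>L. compactin (weak_star (dual (X n))) L \<Longrightarrow>
              L \<subseteq> canonical_embedding (X n) ` vecs (X n) \<Longrightarrow> \<exists>m. L \<subseteq> K n j m"
  shows "\<exists>b m N. L \<subseteq> cover K n j b m N"
proof -
  obtain A where A: "A \<subseteq> vecs S" "L = canonical_embedding S ` A" using L(2) by (auto simp: subset_image_iff)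
  note cpt = L(1)[unfolded A(2)]
  obtain c where c: "\<And>x. x \<in> A \<Longrightarrow> nrm S x \<le> c"
    using compactin_embedded_imp_bounded[OF S_normed A(1) cpt] by blast
  obtain b :: nat where "c \<le> real b" using real_arch_simple by blast
  hence b: "nrm S x \<le> real b" if "x \<in> A" for x using c[OF that] by linarith
  have proj: "biproj n ` L = (\<lambda>x. canonical_embedding (X n) (x n)) ` A"
    unfolding A(2) image_image using A(1) biproj_canonical_embedding by (intro image_cong) auto
  have "biproj n ` L \<subseteq> canonical_embedding (X n) ` vecs (X n)"
    unfolding proj using A(1) coord by blast
  then obtain m where m: "biproj n ` L \<subseteq> K n j m"
    using K[OF image_compactin[OF L(1) continuous_map_biproj]] by blast
  \<comment> \<open>For \<open>p > 1\<close> any \<open>N\<close> will do, as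
    \<open>tail_set\<close> then imposes no bound.\<close>
  have "\<exists>N. p = 1 \<longrightarrow> (\<forall>x\<in>A. nrm S (block {N..} x) \<le> inverse (real (Suc j)))"
    using l1_uniform_tails[OF _ A(1) cpt, of "inverse (real (Suc j))"] by auto
  then obtain N where N: "\<And>x. p = 1 \<Longrightarrow> x \<in> A \<Longrightarrow> nrm S (block {N..} x) \<le> inverse (real (Suc j))"
    by blast
  have "canonical_embedding S x \<in> cover K n j b m N" if "x \<in> A" for x
    using that A(1) b N m[unfolded proj] by (intro canonical_embedding_in_cover) auto
  thus ?thesis unfolding A(2) by blast
qed

end

section \<open>Flattening the indices of the covering\<close>

theorem theorem3p7:
  fixes X :: "nat \<Rightarrow> 'a::real_vector nspace" and p :: real
  assumes "\<And>n. banach_space (X n)"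
    and "1 \<le> p"
  shows "((\<forall>n. K_sigma_delta_Banach (X n)) \<longrightarrow> K_sigma_delta_Banach (lp_sum p X)) \<and>
         ((\<forall>n. strongly_K_sigma_delta_Banach (X n)) \<longrightarrow>
            strongly_K_sigma_delta_Banach (lp_sum p X))"
proof -
  interpret lp_sequence X p
    using assms by unfold_locales (auto simp: banach_space_def)
  \<comment> \<open>The pairing bijection merges the two intersections over \<open>n\<close> and
    \<open>j\<close> into one, and the three unions over \<open>b\<close>, \<open>m\<close> and
    \<open>N\<close> into one, as the definition of the property requires.\<close>
  define pack where "pack K i l = (case prod_decode i of (n, j) \<Rightarrow> case prod_decode l of (b, q) \<Rightarrow>
      case prod_decode q of (m, N) \<Rightarrow> cover K n j b m N)" for K and i l :: nat
  have pack_encode: "pack K (prod_encode (n, j)) (prod_encode (b, prod_encode (m, N))) = cover K n j b m N"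
    for K n j b m N by (simp add: pack_def)
  have pack_INT: "(\<Inter>n. \<Inter>j. \<Union>b. \<Union>m. \<Union>N. cover K n j b m N) = (\<Inter>i. \<Union>l. pack K i l)" for K
  proof (intro equalityI subsetI INT_I)
    fix z i assume z: "z \<in> (\<Inter>n. \<Inter>j. \<Union>b. \<Union>m. \<Union>N. cover K n j b m N)"
    obtain n j where i: "i = prod_encode (n, j)" by (metis prod_decode_inverse surj_pair)
    obtain b m N where "z \<in> cover K n j b m N" using z by blast
    thus "z \<in> (\<Union>l. pack K i l)" unfolding i pack_encode[symmetric] by blast
  next
    fix z n j assume "z \<in> (\<Inter>i. \<Union>l. pack K i l)"
    then obtain l where "z \<in> pack K (prod_encode (n, j)) l" by blast
    thus "z \<in> (\<Union>b. \<Union>m. \<Union>N. cover K n j b m N)" by (auto simp: pack_def split: prod.splits)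
  qed
  have pack_compact: "compactin (weak_star (dual S)) (pack K i l)"
    if "\<And>n j m. compactin (weak_star (dual (X n))) (K n j m)" for K i l
    using that by (auto simp: pack_def intro: compactin_cover split: prod.splits)
  have banach: "banach_space S" by (rule banach_space_lp_sum[OF assms(1)])
  show ?thesis
  proof (intro conjI impI)
    assume "\<forall>n. K_sigma_delta_Banach (X n)"
    hence "\<forall>n. K_sigma_delta_in (weak_star (dual (X n))) (canonical_embedding (X n) ` vecs (X n))"
      by (simp add: K_sigma_delta_Banach_def)
    hence "\<forall>n. \<exists>K. (\<forall>(j::nat) (m::nat). compactin (weak_star (dual (X n))) (K j m)) \<and>
        canonical_embedding (X n) ` vecs (X n) = (\<Inter>j. \<Union>m. K j m)"
      by (simp add: K_sigma_delta_in_def)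
    then obtain K where K: "\<And>n (j::nat) (m::nat). compactin (weak_star (dual (X n))) (K n j m)"
      "\<And>n. canonical_embedding (X n) ` vecs (X n) = (\<Inter>j. \<Union>m. K n j m)" by metis
    show "K_sigma_delta_Banach S"
      unfolding K_sigma_delta_Banach_def K_sigma_delta_in_def
      using banach pack_compact[OF K(1)] canonical_embedding_eq_INT_cover[OF K(2)] pack_INT
      by (intro conjI exI[of _ "pack K"]) auto
  next
    assume "\<forall>n. strongly_K_sigma_delta_Banach (X n)"
    hence "\<forall>n. strongly_K_sigma_delta_in (weak_star (dual (X n))) (canonical_embedding (X n) ` vecs (X n))"
      by (simp add: strongly_K_sigma_delta_Banach_def)
    hence "\<forall>n. \<exists>K. (\<forall>(j::nat) (m::nat). compactin (weak_star (dual (X n))) (K j m)) \<and>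
        canonical_embedding (X n) ` vecs (X n) = (\<Inter>j. \<Union>m. K j m) \<and>
        (\<forall>L j. compactin (weak_star (dual (X n))) L \<and> L \<subseteq> canonical_embedding (X n) ` vecs (X n) \<longrightarrow>
          (\<exists>m. L \<subseteq> K j m))"
      by (simp add: strongly_K_sigma_delta_in_def)
    then obtain K where K: "\<And>n (j::nat) (m::nat). compactin (weak_star (dual (X n))) (K n j m)"
      "\<And>n. canonical_embedding (X n) ` vecs (X n) = (\<Inter>j. \<Union>m. K n j m)"
      "\<And>n j L. compactin (weak_star (dual (X n))) L \<Longrightarrow>
         L \<subseteq> canonical_embedding (X n) ` vecs (X n) \<Longrightarrow> \<exists>m. L \<subseteq> K n j m" by metis
    have "\<exists>l. L \<subseteq> pack K i l"
      if L: "compactin (weak_star (dual S)) L" "L \<subseteq> canonical_embedding S ` vecs S" for L i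
    proof -
      obtain n j where i: "i = prod_encode (n, j)" by (metis prod_decode_inverse surj_pair)
      obtain b m N where "L \<subseteq> cover K n j b m N"
        using compactin_subset_cover[where K = K, OF L K(3)] by blast
      thus ?thesis unfolding i pack_encode[symmetric] by (rule exI)
    qed
    thus "strongly_K_sigma_delta_Banach S"
      unfolding strongly_K_sigma_delta_Banach_def strongly_K_sigma_delta_in_def
      using banach pack_compact[OF K(1)] canonical_embedding_eq_INT_cover[OF K(2)] pack_INT
      by (intro conjI exI[of _ "pack K"]) auto
  qed
qed

end
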